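(* Let $\mathcal{M}$ and $\mathcal{N}$ be two matroids on the same finite ground set $V$. Then \[\chi(\mathcal{M}\cap\mathcal{N})\le \chi(\mathcal{M})+\chi(\mathcal{N}).\]
   Context: A (finite) matroid on $V$ is a nonempty family $\mathcal{M}$ of subsets of $V$ (the independent sets) that is closed under taking subsets and satisfies the augmentation axiom: if $S,T\in\mathcal{M}$ and $|S|<|T|$, there is $v\in T\setminus S$ with $S\cup\{v\}\in\mathcal{M}$. Throughout, the convention is that every element of the ground set of a complex (family of sets closed under subsets) belongs to some set of the complex; in particular every element of $V$ is independent in $\mathcal{M}$ and in $\mathcal{N}$ (no loops). $\mathcal{M}\cap\mathcal{N}$ is the complex of sets independent in both. For a complex $\mathcal{C}$ on ground set $V$, the chromatic number $\chi(\mathcal{C})$ is the minimum number of sets in $\mathcal{C}$ whose union is $V$. *)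

theory Defs
  imports Main
begin

text \<open>A complex with ground set \<open>V\<close>. By convention the ground set of a complex is the union
  of its members, so every element of \<open>V\<close> lies in some member. For a matroid this says that
  there are no loops.\<close>

definition complex_on :: "'a set \<Rightarrow> 'a set set \<Rightarrow> bool" where
  "complex_on V C \<longleftrightarrow> (\<forall>S\<in>C. \<forall>T. T \<subseteq> S \<longrightarrow> T \<in> C) \<and> \<Union>C = V"

definition matroid_on :: "'a set \<Rightarrow> 'a set set \<Rightarrow> bool" where
  "matroid_on V M \<longleftrightarrow>
     finite V \<and> M \<noteq> {} \<and> complex_on V M \<and>
     (\<forall>S\<in>M. \<forall>T\<in>M. card S < card T \<longrightarrow> (\<exists>v\<in>T - S. S \<union> {v} \<in> M))"

text \<open>The \<open>LEAST\<close> ranges over a nonempty set whenever \<open>C\<close> is a complex on the finite set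
  \<open>V\<close>; see \<open>exists_finite_cover\<close> below. The empty ground set is covered by zero sets.\<close>

definition chromatic_number :: "'a set \<Rightarrow> 'a set set \<Rightarrow> nat" where
  "chromatic_number V C = (LEAST k. \<exists>F. F \<subseteq> C \<and> finite F \<and> card F = k \<and> \<Union>F = V)"

lemma singleton_in_complex:
  assumes "complex_on V C" and "v \<in> V"
  shows "{v} \<in> C"
proof -
  obtain S where "S \<in> C" and "v \<in> S"
    using assms unfolding complex_on_def by auto
  moreover from this have "{v} \<subseteq> S" by simp
  ultimately show ?thesis using assms(1) unfolding complex_on_def by metis
qed

lemma complex_on_Int:
  assumes C: "complex_on V C" and D: "complex_on V D"
  shows "complex_on V (C \<inter> D)"
  unfolding complex_on_def
proof (intro conjI ballI allI impI)
  fix S T assume "S \<in> C \<inter> D" and "T \<subseteq> S"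
  then show "T \<in> C \<inter> D"
    using C D unfolding complex_on_def by (metis IntD1 IntD2 IntI)
next
  show "\<Union>(C \<inter> D) = V"
  proof
    show "\<Union>(C \<inter> D) \<subseteq> V"
      using C unfolding complex_on_def by auto
    show "V \<subseteq> \<Union>(C \<inter> D)"
    proof
      fix v assume "v \<in> V"
      then have "{v} \<in> C \<inter> D"
        using singleton_in_complex[OF C] singleton_in_complex[OF D] by simp
      then show "v \<in> \<Union>(C \<inter> D)" by (rule UnionI) simp
    qed
  qed
qed

lemma exists_finite_cover:
  assumes "finite V" and "complex_on V C"
  shows "\<exists>k F. F \<subseteq> C \<and> finite F \<and> card F = k \<and> \<Union>F = V"
proof (intro exI conjI)
  show "(\<lambda>v. {v}) ` V \<subseteq> C"
    using singleton_in_complex[OF assms(2)] by (rule image_subsetI)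
  show "finite ((\<lambda>v. {v}) ` V)" using assms(1) by (rule finite_imageI)
  show "card ((\<lambda>v. {v}) ` V) = card ((\<lambda>v. {v}) ` V)" by (rule refl)
  show "\<Union>((\<lambda>v. {v}) ` V) = V" by simp
qed

end

theory Submission
  imports Defs Complex_Main "HOL-Library.Z2"
begin

text \<open>The bound follows from a lower bound on the connectivity of \<open>M \<inter> N\<close>: if a weight
  \<open>x \<ge> 0\<close> satisfies \<open>x(A) \<le> p r\<^sub>M(A)\<close> and \<open>x(A) \<le> q r\<^sub>N(A)\<close> for all \<open>A\<close>, then
  the homology of \<open>M \<inter> N\<close> vanishes below a dimension of about \<open>x(V) / (p + q)\<close>. By an
  extreme point argument one may assume that some \<open>v\<close> has weight exactly \<open>min p q\<close>, say \<open>p\<close>.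
  Remove from \<open>M \<inter> N\<close> all minimal faces \<open>D\<close> such that \<open>D + v\<close> is dependent in \<open>M\<close>, then
  those such that \<open>D + v\<close> is dependent in \<open>N\<close>; what is left is a cone over \<open>v\<close>. By circuit
  elimination no face contains two of the removed faces of the same kind, so the links are the matroid
  intersections \<open>M/D \<inter> N/D\<close> and \<open>M/(D + v) \<inter> N/D\<close>, and each loses at most
  \<open>(p + q) card D\<close> of the weight: in the second case the additional loss \<open>p\<close> is compensated by
  \<open>v\<close>, whose weight would otherwise be counted twice.

  A covering of \<open>V\<close> by \<open>k = \<chi>(M) + \<chi>(N)\<close> common independent sets is a rainbow face of
  the intersection of the \<open>k\<close>-fold direct sums of \<open>M\<close> and of \<open>N\<close> on \<open>V \<times> {..<k}\<close>,
  where \<open>(v, i)\<close> has colour \<open>v\<close>. With unit weights the connectivity bound is exactly the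
  hypothesis of the topological Hall theorem.\<close>

section \<open>Homology modulo 2\<close>

declare add_bit_eq_xor [simp del] mult_bit_eq_and [simp del] bit_not_zero_iff [simp del]

text \<open>The coefficient of the simplicial boundary at \<open>s\<close>, read off from the faces
  that have \<open>s\<close> as a facet; over \<open>bit\<close> there are no signs or
  orientations.\<close>

definition boundary :: "'a set \<Rightarrow> ('a set \<Rightarrow> bit) \<Rightarrow> 'a set \<Rightarrow> bit" where
  "boundary V c s = (\<Sum>v\<in>V - s. c (insert v s))"

text \<open>Chains are graded by the number of vertices, so the grade of a chain is one more than
  the dimension of its faces, and the empty face makes the homology reduced.\<close>

definition mod2_chains :: "'a set set \<Rightarrow> nat \<Rightarrow> ('a set \<Rightarrow> bit) set" where
  "mod2_chains C k = {c. \<forall>s. c s \<noteq> 0 \<longrightarrow> s \<in> C \<and> card s = k}"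

text \<open>For a complex on \<open>V\<close> this says that reduced homology vanishes up to
  dimension \<open>n - 2\<close>; for \<open>n = 1\<close> it says that a complex containing
  \<open>{}\<close> has a vertex.\<close>

definition acyclic_below :: "'a set \<Rightarrow> 'a set set \<Rightarrow> nat \<Rightarrow> bool" where
  "acyclic_below V C n \<longleftrightarrow> (\<forall>k<n. \<forall>z\<in>mod2_chains C k. boundary V z = (\<lambda>_. 0) \<longrightarrow>
     (\<exists>w\<in>mod2_chains C (Suc k). boundary V w = z))"

definition link :: "'a set set \<Rightarrow> 'a set \<Rightarrow> 'a set set" where
  "link C s = {t. t \<inter> s = {} \<and> t \<union> s \<in> C}"

lemma acyclic_belowD:
  assumes "acyclic_below V C n" "k < n" "z \<in> mod2_chains C k" "boundary V z = (\<lambda>_. 0)"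
  obtains w where "w \<in> mod2_chains C (Suc k)" "boundary V w = z"
  using assms unfolding acyclic_below_def by blast

lemma bit_add_cancel: "(a::bit) + (b + a) = b" "a + (a + b) = b" "a + a = 0"
  by (cases a; cases b; simp add: add_bit_eq_xor)+

text \<open>Each unordered pair of distinct elements contributes twice, hence zero in
  \<open>bit\<close>.\<close>

lemma sum_symmetric_pairs:
  fixes g :: "'a \<Rightarrow> 'a \<Rightarrow> bit"
  assumes "finite A" "\<And>v w. v \<in> A \<Longrightarrow> w \<in> A \<Longrightarrow> g v w = g w v"
  shows "(\<Sum>v\<in>A. \<Sum>w\<in>A - {v}. g v w) = 0"
  using assms
proof (induction A rule: finite_induct)
  case (insert a A)
  have 1: "(\<Sum>w\<in>insert a A - {v}. g v w) = g v a + (\<Sum>w\<in>A - {v}. g v w)" if "v \<in> A" for v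
  proof -
    have "insert a A - {v} = insert a (A - {v})" using that insert by auto
    then show ?thesis using insert by simp
  qed
  have "(\<Sum>v\<in>insert a A. \<Sum>w\<in>insert a A - {v}. g v w)
      = (\<Sum>w\<in>A. g a w) + (\<Sum>v\<in>A. g v a + (\<Sum>w\<in>A - {v}. g v w))"
    using insert 1 by (simp add: insert_Diff_if)
  also have "\<dots> = (\<Sum>w\<in>A. g a w) + ((\<Sum>v\<in>A. g v a) + 0)"
    using insert by (simp add: sum.distrib)
  also have "(\<Sum>v\<in>A. g v a) = (\<Sum>w\<in>A. g a w)"
    using insert by (intro sum.cong) auto
  finally show ?case by (simp add: bit_add_cancel)
qed simp

lemma boundary_boundary:
  assumes "finite V"
  shows "boundary V (boundary V c) = (\<lambda>_. 0)"
proof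
  fix s
  have "boundary V (boundary V c) s = (\<Sum>v\<in>V - s. \<Sum>w\<in>(V - s) - {v}. c (insert w (insert v s)))"
    unfolding boundary_def by (intro sum.cong refl) auto
  also have "\<dots> = 0"
    by (rule sum_symmetric_pairs) (use assms in \<open>auto simp: insert_commute\<close>)
  finally show "boundary V (boundary V c) s = 0" .
qed

lemma boundary_add: "boundary V (\<lambda>s. c s + d s) = (\<lambda>s. boundary V c s + boundary V d s)"
  by (auto simp: boundary_def sum.distrib fun_eq_iff)

lemma mod2_chains_add: "c \<in> mod2_chains C k \<Longrightarrow> d \<in> mod2_chains C k \<Longrightarrow> (\<lambda>s. c s + d s) \<in> mod2_chains C k"
  unfolding mod2_chains_def by force

lemma mod2_chains_sum:
  "finite I \<Longrightarrow> (\<And>i. i \<in> I \<Longrightarrow> c i \<in> mod2_chains C k) \<Longrightarrow> (\<lambda>s. \<Sum>i\<in>I. c i s) \<in> mod2_chains C k"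
proof (induction I rule: finite_induct)
  case empty then show ?case by (simp add: mod2_chains_def)
next
  case (insert i I) then show ?case using mod2_chains_add[of "c i" C k] by simp
qed

lemma mod2_chains_mono: "c \<in> mod2_chains C k \<Longrightarrow> C \<subseteq> D \<Longrightarrow> c \<in> mod2_chains D k"
  unfolding mod2_chains_def by auto

lemma boundary_chains:
  assumes "c \<in> mod2_chains C (Suc k)" "\<And>s t. s \<in> C \<Longrightarrow> t \<subseteq> s \<Longrightarrow> t \<in> C" "\<And>s. s \<in> C \<Longrightarrow> finite s"
  shows "boundary V c \<in> mod2_chains C k"
  unfolding mod2_chains_def
proof (intro CollectI allI impI)
  fix s assume "boundary V c s \<noteq> 0"
  then obtain v where "v \<in> V - s" "c (insert v s) \<noteq> 0"
    unfolding boundary_def by (meson sum.neutral)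
  then have "v \<notin> s" "insert v s \<in> C" "card (insert v s) = Suc k"
    using assms(1) unfolding mod2_chains_def by auto
  then show "s \<in> C \<and> card s = k"
    using assms(2)[of "insert v s" s] assms(3)[of "insert v s"] by auto
qed

text \<open>Coning with apex \<open>v\<close> the faces of a cycle that avoid \<open>v\<close> gives
  a filling. At a face \<open>s\<close> containing \<open>v\<close> this is the cycle equation at
  \<open>s - {v}\<close>.\<close>

lemma acyclic_below_cone:
  assumes "finite V" "v \<in> V" "C \<subseteq> Pow V" "\<And>s. s \<in> C \<Longrightarrow> insert v s \<in> C"
  shows "acyclic_below V C n"
  unfolding acyclic_below_def
proof (intro allI impI ballI)
  fix k z assume z: "z \<in> mod2_chains C k" and dz: "boundary V z = (\<lambda>_. 0)"
  define w where "w = (\<lambda>s. if v \<in> s then z (s - {v}) else 0)"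
  have "w \<in> mod2_chains C (Suc k)"
    unfolding mod2_chains_def
  proof (intro CollectI allI impI)
    fix s assume "w s \<noteq> 0"
    then have "v \<in> s" "z (s - {v}) \<noteq> 0" by (auto simp: w_def split: if_splits)
    then have "s - {v} \<in> C" "card (s - {v}) = k" using z unfolding mod2_chains_def by auto
    moreover have "finite (s - {v})" using calculation(1) assms finite_subset by blast
    ultimately show "s \<in> C \<and> card s = Suc k"
      using assms(4)[of "s - {v}"] \<open>v \<in> s\<close> card_Suc_Diff1[of s v] by (simp add: insert_absorb)
  qed
  moreover have "boundary V w s = z s" for s
  proof (cases "v \<in> s")
    case False
    have "boundary V w s = (\<Sum>u\<in>V - s. if u = v then z s else 0)"
      unfolding boundary_def w_def using False by (intro sum.cong) auto
    then show ?thesis using assms False by (simp add: sum.delta')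
  next
    case True
    let ?r = "s - {v}"
    have "0 = boundary V z ?r" using dz by simp
    also have "\<dots> = (\<Sum>u\<in>insert v (V - s). z (insert u ?r))"
      unfolding boundary_def using assms True by (intro sum.cong) auto
    also have "\<dots> = z s + (\<Sum>u\<in>V - s. z (insert u ?r))"
      using assms True by (simp add: insert_absorb)
    also have "(\<Sum>u\<in>V - s. z (insert u ?r)) = boundary V w s"
      unfolding boundary_def w_def using True by (intro sum.cong refl) (auto simp: insert_Diff_if)
    finally show ?thesis by (metis bit_add_cancel(2) add_0_right)
  qed
  ultimately show "\<exists>w\<in>mod2_chains C (Suc k). boundary V w = z" by blast
qed

text \<open>The part of a cycle on faces through \<open>f\<close> is a cycle in the link,
  \<open>card f\<close> grades lower. Its filling there, joined with \<open>f\<close>, removes this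
  part up to a boundary, and the remainder avoids \<open>f\<close>.\<close>

lemma acyclic_below_remove_face:
  assumes V: "finite V" "C \<subseteq> Pow V" and down: "\<And>s t. s \<in> C \<Longrightarrow> t \<subseteq> s \<Longrightarrow> t \<in> C"
    and f: "f \<subseteq> V"
    and rest: "acyclic_below V {s \<in> C. \<not> f \<subseteq> s} n"
    and link: "acyclic_below V (link C f) (n - card f)"
  shows "acyclic_below V C n"
  unfolding acyclic_below_def
proof (intro allI impI ballI)
  fix k z assume k: "k < n" and z: "z \<in> mod2_chains C k" and dz: "boundary V z = (\<lambda>_. 0)"
  let ?R = "{s \<in> C. \<not> f \<subseteq> s}"
  have fin: "finite s" if "s \<in> C" for s using that V finite_subset by blast
  have finf: "finite f" using f V finite_subset by blast
  show "\<exists>w\<in>mod2_chains C (Suc k). boundary V w = z"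
  proof (cases "card f \<le> k")
    case False
    have "z \<in> mod2_chains ?R k"
      unfolding mod2_chains_def
    proof (intro CollectI allI impI)
      fix s assume "z s \<noteq> 0"
      then have "s \<in> C" "card s = k" using z unfolding mod2_chains_def by auto
      moreover have "\<not> f \<subseteq> s" using card_mono[OF fin[OF \<open>s \<in> C\<close>]] False \<open>card s = k\<close> by blast
      ultimately show "s \<in> ?R \<and> card s = k" by blast
    qed
    then obtain w where w: "w \<in> mod2_chains ?R (Suc k)" "boundary V w = z"
      by (rule acyclic_belowD[OF rest k _ dz])
    have "w \<in> mod2_chains C (Suc k)" using w(1) by (rule mod2_chains_mono) auto
    then show ?thesis using w(2) by blast
  next
    case True
    \<comment> \<open>\<open>a\<close> is the part of \<open>z\<close> through \<open>f\<close>,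
      with \<open>f\<close> stripped off.\<close>
    define a where "a = (\<lambda>r. if r \<inter> f = {} then z (r \<union> f) else 0)"
    have a: "a \<in> mod2_chains (link C f) (k - card f)"
      unfolding mod2_chains_def
    proof (intro CollectI allI impI)
      fix r assume "a r \<noteq> 0"
      then have r: "r \<inter> f = {}" "z (r \<union> f) \<noteq> 0" by (auto simp: a_def split: if_splits)
      then have "r \<union> f \<in> C" "card (r \<union> f) = k" using z unfolding mod2_chains_def by auto
      then show "r \<in> link C f \<and> card r = k - card f"
        using r fin[of "r \<union> f"] by (auto simp: link_def card_Un_disjoint)
    qed
    have "boundary V a r = 0" for r
    proof (cases "r \<inter> f = {}")
      case True
      have "boundary V a r = (\<Sum>v\<in>V - (r \<union> f). z (insert v (r \<union> f)))"
        unfolding boundary_def a_def using V True by (intro sum.mono_neutral_cong_right) auto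
      also have "\<dots> = boundary V z (r \<union> f)" by (simp add: boundary_def)
      finally show ?thesis using dz by simp
    next
      case False
      then show ?thesis unfolding boundary_def a_def by (intro sum.neutral) auto
    qed
    then have da: "boundary V a = (\<lambda>_. 0)" by auto
    have "k - card f < n - card f" using k True by simp
    then obtain w where w: "w \<in> mod2_chains (link C f) (Suc (k - card f))" "boundary V w = a"
      by (rule acyclic_belowD[OF link _ a da])
    \<comment> \<open>\<open>W\<close> is the join of the filling \<open>w\<close> with
      \<open>f\<close>; its boundary agrees with \<open>z\<close> on all faces through
      \<open>f\<close>.\<close>
    define W where "W = (\<lambda>s. if f \<subseteq> s then w (s - f) else 0)"
    have W: "W \<in> mod2_chains C (Suc k)"
      unfolding mod2_chains_def
    proof (intro CollectI allI impI)
      fix s assume "W s \<noteq> 0"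
      then have s: "f \<subseteq> s" "w (s - f) \<noteq> 0" by (auto simp: W_def split: if_splits)
      then have "s - f \<in> link C f" "card (s - f) = Suc (k - card f)"
        using w(1) unfolding mod2_chains_def by auto
      moreover have "(s - f) \<union> f = s" using s by auto
      ultimately have "s \<in> C" by (simp add: link_def)
      moreover have "card s = card (s - f) + card f"
        using card_Diff_subset[OF finf s(1)] card_mono[OF fin[OF calculation] s(1)] by simp
      ultimately show "s \<in> C \<and> card s = Suc k"
        using \<open>card (s - f) = Suc (k - card f)\<close> True by simp
    qed
    have bW: "boundary V W s = z s" if "f \<subseteq> s" for s
    proof -
      have "boundary V W s = (\<Sum>v\<in>V - s. w (insert v (s - f)))"
        unfolding boundary_def W_def using that by (intro sum.cong refl) (auto simp: insert_Diff_if)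
      also have "\<dots> = boundary V w (s - f)"
        unfolding boundary_def
      proof (rule sum.mono_neutral_left)
        show "\<forall>v\<in>V - (s - f) - (V - s). w (insert v (s - f)) = 0"
        proof
          fix v assume "v \<in> V - (s - f) - (V - s)"
          then have "insert v (s - f) \<notin> link C f" by (auto simp: link_def)
          then show "w (insert v (s - f)) = 0" using w(1) by (auto simp: mod2_chains_def)
        qed
      qed (use V in auto)
      also have "\<dots> = z s" using w(2) that by (auto simp: a_def Un_absorb2)
      finally show ?thesis .
    qed
    define z' where "z' = (\<lambda>s. z s + boundary V W s)"
    have "boundary V W \<in> mod2_chains C k"
      by (rule boundary_chains[OF W down fin])
    then have "z' \<in> mod2_chains C k"
      unfolding z'_def by (rule mod2_chains_add[OF z])
    moreover have "z' s = 0" if "f \<subseteq> s" for s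
      unfolding z'_def using bW[OF that] by (simp add: bit_add_cancel)
    ultimately have z': "z' \<in> mod2_chains ?R k" by (auto simp: mod2_chains_def)
    have dz': "boundary V z' = (\<lambda>_. 0)"
      unfolding z'_def boundary_add using dz boundary_boundary[OF V(1)] by simp
    obtain u where u: "u \<in> mod2_chains ?R (Suc k)" "boundary V u = z'"
      by (rule acyclic_belowD[OF rest k z' dz'])
    have "u \<in> mod2_chains C (Suc k)" using u(1) by (rule mod2_chains_mono) auto
    then have "(\<lambda>s. W s + u s) \<in> mod2_chains C (Suc k)" by (rule mod2_chains_add[OF W])
    moreover have "boundary V (\<lambda>s. W s + u s) = z"
      unfolding boundary_add u(2) z'_def by (simp add: bit_add_cancel)
    ultimately show ?thesis by (intro bexI[where x = "\<lambda>s. W s + u s"])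
  qed
qed

text \<open>By \<open>disj\<close> no face through \<open>f\<close> contains a second member of
  \<open>F\<close>. Deleting the faces through the other members thus leaves the link of
  \<open>f\<close> unchanged, and the members can be treated one at a time.\<close>

lemma acyclic_below_remove_faces:
  assumes V: "finite V" "C \<subseteq> Pow V" and down: "\<And>s t. s \<in> C \<Longrightarrow> t \<subseteq> s \<Longrightarrow> t \<in> C"
    and F: "finite F" "F \<subseteq> Pow V"
    and disj: "\<And>f g. f \<in> F \<Longrightarrow> g \<in> F \<Longrightarrow> f \<noteq> g \<Longrightarrow> f \<union> g \<notin> C"
    and rest: "acyclic_below V {s \<in> C. \<forall>f\<in>F. \<not> f \<subseteq> s} n"
    and links: "\<And>f. f \<in> F \<Longrightarrow> acyclic_below V (link C f) (n - card f)"
  shows "acyclic_below V C n"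
  using F disj rest links
proof (induction F rule: finite_induct)
  case empty then show ?case by simp
next
  case (insert f F)
  let ?C = "{s \<in> C. \<forall>g\<in>F. \<not> g \<subseteq> s}"
  have no: "\<not> g \<subseteq> t \<union> f" if g: "g \<in> F" and t: "t \<union> f \<in> C" for g t
  proof
    assume "g \<subseteq> t \<union> f"
    then have "f \<union> g \<in> C" using down[OF t, of "f \<union> g"] by simp
    moreover have "f \<union> g \<notin> C"
      by (rule insert.prems(2)) (use g insert.hyps in auto)
    ultimately show False by simp
  qed
  have "link ?C f = link C f"
  proof -
    have "t \<union> f \<in> ?C \<longleftrightarrow> t \<union> f \<in> C" for t using no[of _ t] by auto
    then show ?thesis by (simp only: link_def)
  qed
  moreover have "acyclic_below V (link C f) (n - card f)" by (rule insert.prems(4)) simp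
  ultimately have 1: "acyclic_below V (link ?C f) (n - card f)" by (simp only:)
  have "{s \<in> ?C. \<not> f \<subseteq> s} = {s \<in> C. \<forall>g\<in>insert f F. \<not> g \<subseteq> s}" by auto
  then have 2: "acyclic_below V {s \<in> ?C. \<not> f \<subseteq> s} n" using insert.prems(3) by (simp only:)
  have rest: "acyclic_below V ?C n"
  proof (rule acyclic_below_remove_face[OF V(1) _ _ _ 2 1])
    show "?C \<subseteq> Pow V" using V by auto
    show "f \<subseteq> V" using insert.prems(1) by simp
    fix s t assume s: "s \<in> ?C" and "t \<subseteq> s"
    moreover have "t \<in> C" using s \<open>t \<subseteq> s\<close> by (intro down[of s t]) simp_all
    ultimately show "t \<in> ?C" by blast
  qed
  show ?case
  proof (rule insert.IH)
    show "F \<subseteq> Pow V" using insert.prems(1) by simp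
    show "acyclic_below V ?C n" by (rule rest)
    show "f \<union> g \<notin> C" if "f \<in> F" "g \<in> F" "f \<noteq> g" for f g
      by (rule insert.prems(2)) (use that in auto)
    show "acyclic_below V (link C f) (n - card f)" if "f \<in> F" for f
      by (rule insert.prems(4)) (use that in auto)
  qed
qed

section \<open>The topological Hall theorem\<close>

definition rainbow :: "('a \<Rightarrow> 'b) \<Rightarrow> 'b set \<Rightarrow> 'a set \<Rightarrow> bool" where
  "rainbow col J s \<longleftrightarrow> inj_on col s \<and> col ` s = J"

text \<open>For finite \<open>J\<close> and a chain in grade \<open>card J\<close>, this is the
  coefficient at \<open>J\<close> of its image under the chain map induced by
  \<open>col\<close>.\<close>

definition rainbow_count :: "'a set \<Rightarrow> ('a \<Rightarrow> 'b) \<Rightarrow> 'b set \<Rightarrow> ('a set \<Rightarrow> bit) \<Rightarrow> bit" where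
  "rainbow_count V col J c = (\<Sum>s | s \<subseteq> V \<and> rainbow col J s. c s)"

text \<open>Sperner's parity count: a face is missing at most one colour, and if it is not rainbow
  then its facets avoiding colour \<open>i\<close> come in pairs.\<close>

lemma rainbow_facets_parity:
  assumes s: "finite s" "col ` s \<subseteq> J" "card s = card J" and i: "i \<in> J" and J: "finite J"
  shows "of_nat (card {v \<in> s. rainbow col (J - {i}) (s - {v})}) = (if rainbow col J s then 1 else 0 :: bit)"
proof (cases "rainbow col J s")
  case True
  then obtain v where v: "v \<in> s" "col v = i" using i by (auto simp: rainbow_def)
  have inj: "inj_on col s" and im: "col ` s = J" using True by (auto simp: rainbow_def)
  have "{w \<in> s. rainbow col (J - {i}) (s - {w})} = {v}"
  proof -
    have "col ` (s - {w}) = J - {col w}" if "w \<in> s" for w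
      using inj_on_image_set_diff[OF inj, of s "{w}"] im that by simp
    moreover have "inj_on col (s - {w})" for w using inj by (rule inj_on_diff)
    moreover have "J - {col w} = J - {i} \<longleftrightarrow> w = v" if "w \<in> s" for w
    proof
      assume "J - {col w} = J - {i}"
      moreover have "col w \<in> J" using im that by auto
      ultimately have "col w = col v" using i v by blast
      then show "w = v" using inj that v by (auto dest: inj_onD)
    qed (use v in simp)
    ultimately show ?thesis using v by (auto simp: rainbow_def)
  qed
  then show ?thesis using True by simp
next
  case False
  show ?thesis
  proof (cases "\<exists>v\<in>s. rainbow col (J - {i}) (s - {v})")
    case no: False
    then have "{v \<in> s. rainbow col (J - {i}) (s - {v})} = {}" by auto
    then show ?thesis using False by (simp only: card.empty of_nat_0 if_False)
  next
    case True
    then obtain v where v: "v \<in> s" "inj_on col (s - {v})" "col ` (s - {v}) = J - {i}"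
      by (auto simp: rainbow_def)
    have "col v \<noteq> i"
    proof
      assume "col v = i"
      then have "col ` s = J" using v i by auto
      moreover have "inj_on col s"
        by (rule eq_card_imp_inj_on) (simp_all add: calculation s)
      ultimately show False using False by (simp add: rainbow_def)
    qed
    then have "col v \<in> col ` (s - {v})" using v s by auto
    then obtain u where "col v = col u" "u \<in> s - {v}" by (rule imageE)
    then have u: "u \<in> s" "u \<noteq> v" "col u = col v" by simp_all
    \<comment> \<open>\<open>u\<close> and \<open>v\<close> share a colour; deleting one of these
      two, and no other vertex, leaves a facet with the colours \<open>J - {i}\<close>.\<close>
    have "rainbow col (J - {i}) (s - {w}) \<longleftrightarrow> w = v \<or> w = u" if w: "w \<in> s" for w
    proof
      assume "rainbow col (J - {i}) (s - {w})"
      then have "inj_on col (s - {w})" by (simp add: rainbow_def)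
      then have "u = v" if "w \<noteq> v" "w \<noteq> u"
        by (rule inj_onD[of col "s - {w}" u v]) (use that u v(1) in auto)
      then show "w = v \<or> w = u" using u(2) by blast
    next
      assume "w = v \<or> w = u"
      moreover have "rainbow col (J - {i}) (s - {u})"
      proof -
        have "col ` (s - {a}) \<subseteq> col ` (s - {b})"
          if ab: "a \<in> s" "b \<in> s" "a \<noteq> b" "col a = col b" for a b
        proof
          fix y assume "y \<in> col ` (s - {a})"
          then obtain w where w: "w \<in> s - {a}" "y = col w" by blast
          show "y \<in> col ` (s - {b})"
          proof (cases "w = b")
            case True then show ?thesis using w ab by (intro image_eqI[of _ _ a]) auto
          next
            case False then show ?thesis using w by (intro image_eqI[of _ _ w]) auto
          qed
        qed
        then have "col ` (s - {u}) = col ` (s - {v})"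
          using u v(1) by (intro subset_antisym) simp_all
        then have "col ` (s - {u}) = J - {i}" using v by simp
        moreover have "card (s - {u}) = card (J - {i})" using u i s J by simp
        ultimately show ?thesis using s by (simp add: rainbow_def eq_card_imp_inj_on)
      qed
      ultimately show "rainbow col (J - {i}) (s - {w})" using v by (auto simp: rainbow_def)
    qed
    then have "{w \<in> s. rainbow col (J - {i}) (s - {w})} = {u, v}" using u v by auto
    then show ?thesis using False u by simp
  qed
qed

text \<open>Double counting of the pairs of a face and a facet of it with colours
  \<open>J - {i}\<close>: the facets of a face in the support of \<open>c\<close> cancel unless the
  face is rainbow.\<close>

lemma rainbow_count_boundary:
  assumes V: "finite V" and c: "c \<in> mod2_chains {s. s \<subseteq> V \<and> col ` s \<subseteq> J} (card J)"
    and i: "i \<in> J" and J: "finite J"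
  shows "rainbow_count V col (J - {i}) (boundary V c) = rainbow_count V col J c"
proof -
  let ?R = "\<lambda>J. {s. s \<subseteq> V \<and> rainbow col J s}"
  let ?B = "\<lambda>s. {v \<in> s. rainbow col (J - {i}) (s - {v})}"
  have fin: "finite (?R J)" for J using V by simp
  have "rainbow_count V col (J - {i}) (boundary V c)
      = (\<Sum>(t, v)\<in>Sigma (?R (J - {i})) (\<lambda>t. V - t). c (insert v t))"
    unfolding rainbow_count_def boundary_def using V fin by (subst sum.Sigma) auto
  also have "\<dots> = (\<Sum>(s, v)\<in>Sigma (Pow V) ?B. c s)"
    by (rule sum.reindex_bij_witness[where i = "\<lambda>(s, v). (s - {v}, v)"
          and j = "\<lambda>(t, v). (insert v t, v)"]) (auto simp: insert_absorb)
  also have "\<dots> = (\<Sum>s\<in>Pow V. \<Sum>v\<in>?B s. c s)"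
  proof (rule sum.Sigma[symmetric])
    show "\<forall>s\<in>Pow V. finite (?B s)" using V by (auto intro: finite_subset)
  qed (use V in simp)
  also have "\<dots> = (\<Sum>s\<in>Pow V. if rainbow col J s then c s else 0)"
  proof (rule sum.cong)
    fix s assume s: "s \<in> Pow V"
    show "(\<Sum>v\<in>?B s. c s) = (if rainbow col J s then c s else 0)"
    proof (cases "c s = 0")
      case True then show ?thesis by simp
    next
      case False
      then have "col ` s \<subseteq> J" "card s = card J" using c by (auto simp: mod2_chains_def)
      then have "of_nat (card (?B s)) = (if rainbow col J s then 1 else 0 :: bit)"
        using s V finite_subset by (intro rainbow_facets_parity[OF _ _ _ i J]) auto
      then show ?thesis by simp
    qed
  qed simp
  also have "\<dots> = rainbow_count V col J c"
    unfolding rainbow_count_def using V by (subst sum.inter_filter[symmetric]) auto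
  finally show ?thesis .
qed

text \<open>The acyclicity allows one to fill a chain map from the full
  simplex on \<open>I\<close> into \<open>C\<close> that respects colours; composing it with \<open>col\<close> is the
  identity modulo 2, so the top chain contains a rainbow face.\<close>

theorem rainbow_face:
  assumes V: "finite V" "C \<subseteq> Pow V" and down: "\<And>s t. s \<in> C \<Longrightarrow> t \<subseteq> s \<Longrightarrow> t \<in> C"
    and "{} \<in> C" and I: "finite I"
    and acyc: "\<And>J. J \<subseteq> I \<Longrightarrow> acyclic_below V {s \<in> C. col ` s \<subseteq> J} (card J)"
  shows "\<exists>s\<in>C. rainbow col I s"
proof -
  let ?C = "\<lambda>J. {s \<in> C. col ` s \<subseteq> J}"
  \<comment> \<open>\<open>f J\<close> is the image of the simplex \<open>J\<close> under a chain
    map. The value at \<open>{}\<close> is the normalization that excludes the zero map.\<close>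
  define good where "good f J \<longleftrightarrow> f J \<in> mod2_chains (?C J) (card J) \<and>
     (J \<noteq> {} \<longrightarrow> boundary V (f J) = (\<lambda>s. \<Sum>i\<in>J. f (J - {i}) s)) \<and>
     (J = {} \<longrightarrow> f J = (\<lambda>s. if s = {} then 1 else 0))" for f J
  have "\<exists>f. \<forall>J\<subseteq>I. card J \<le> n \<longrightarrow> good f J" for n
  proof (induction n)
    case 0
    have "good (\<lambda>_ s. if s = {} then 1 else 0) {}"
      using \<open>{} \<in> C\<close> by (auto simp: good_def mod2_chains_def)
    moreover have "J = {}" if "J \<subseteq> I" "card J \<le> 0" for J
      using that I finite_subset by fastforce
    ultimately show ?case by (intro exI[of _ "\<lambda>_ s. if s = {} then 1 else 0"]) blast
  next
    case (Suc n)
    then obtain f where f: "good f J" if "J \<subseteq> I" "card J \<le> n" for J by blast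
    \<comment> \<open>The images of the facets of \<open>J\<close> add up to a cycle of grade
      \<open>n\<close>, one below \<open>card J\<close>, where acyclicity just applies.\<close>
    have fill: "\<exists>w. w \<in> mod2_chains (?C J) (Suc n) \<and> boundary V w = (\<lambda>s. \<Sum>i\<in>J. f (J - {i}) s)"
      if J: "J \<subseteq> I" "card J = Suc n" for J
    proof -
      let ?z = "\<lambda>s. \<Sum>i\<in>J. f (J - {i}) s"
      have finJ: "finite J" using J I finite_subset by blast
      have gi: "good f (J - {i})" "card (J - {i}) = n" if "i \<in> J" for i
        using J that finJ by (auto intro!: f)
      have z: "?z \<in> mod2_chains (?C J) n"
      proof (rule mod2_chains_sum[OF finJ])
        fix i assume "i \<in> J"
        then have "f (J - {i}) \<in> mod2_chains (?C (J - {i})) n" using gi[of i] by (simp add: good_def)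
        then show "f (J - {i}) \<in> mod2_chains (?C J) n" by (rule mod2_chains_mono) auto
      qed
      have dz: "boundary V ?z = (\<lambda>_. 0)"
      proof
        fix s
        have "boundary V ?z s = (\<Sum>i\<in>J. boundary V (f (J - {i})) s)"
          unfolding boundary_def by (rule sum.swap)
        also have "\<dots> = (\<Sum>i\<in>J. \<Sum>j\<in>J - {i}. f (J - {i} - {j}) s)"
        proof (rule sum.cong[OF refl])
          fix i assume i: "i \<in> J"
          show "boundary V (f (J - {i})) s = (\<Sum>j\<in>J - {i}. f (J - {i} - {j}) s)"
          proof (cases "J - {i} = {}")
            case True
            have "f {} = (\<lambda>s. if s = {} then 1 else 0)" using gi[OF i] True by (simp add: good_def)
            then show ?thesis unfolding True by (simp add: boundary_def)
          next
            case False
            then show ?thesis using gi[OF i] by (simp add: good_def)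
          qed
        qed
        also have "\<dots> = 0"
          using finJ by (intro sum_symmetric_pairs) (auto simp: Diff_insert2[symmetric] insert_commute)
        finally show "boundary V ?z s = 0" .
      qed
      have "acyclic_below V (?C J) (Suc n)" using acyc[of J] J by simp
      then obtain w where "w \<in> mod2_chains (?C J) (Suc n)" "boundary V w = ?z"
        by (rule acyclic_belowD[OF _ lessI z dz])
      then show ?thesis by (intro exI[of _ w] conjI)
    qed
    define w where "w J = (SOME w. w \<in> mod2_chains (?C J) (Suc n) \<and>
        boundary V w = (\<lambda>s. \<Sum>i\<in>J. f (J - {i}) s))" for J
    have w: "w J \<in> mod2_chains (?C J) (Suc n) \<and> boundary V (w J) = (\<lambda>s. \<Sum>i\<in>J. f (J - {i}) s)"
      if "J \<subseteq> I" "card J = Suc n" for J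
      unfolding w_def by (rule someI_ex[OF fill[OF that]])
    define g where "g J = (if card J = Suc n then w J else f J)" for J
    have "good g J" if J: "J \<subseteq> I" "card J \<le> Suc n" for J
    proof -
      have finJ: "finite J" using J I finite_subset by blast
      have lower: "(\<lambda>s. \<Sum>i\<in>J. g (J - {i}) s) = (\<lambda>s. \<Sum>i\<in>J. f (J - {i}) s)"
      proof (intro ext sum.cong refl)
        fix i s assume "i \<in> J"
        then have "card (J - {i}) < Suc n" using J finJ card_Diff1_less[of J i] by linarith
        then show "g (J - {i}) s = f (J - {i}) s" by (simp add: g_def)
      qed
      show ?thesis
      proof (cases "card J = Suc n")
        case True
        then have "g J = w J" "J \<noteq> {}" by (auto simp: g_def)
        then show ?thesis unfolding good_def lower using w[OF J(1) True] True by simp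
      next
        case False
        then have gJ: "g J = f J" and "card J \<le> n" using J by (auto simp: g_def)
        then have "good f J" using f[OF J(1)] by simp
        then show ?thesis unfolding good_def lower gJ .
      qed
    qed
    then show ?case by (intro exI[of _ g] allI impI)
  qed
  from this[of "card I"] obtain f where "\<forall>J\<subseteq>I. card J \<le> card I \<longrightarrow> good f J" ..
  then have f: "good f J" if "J \<subseteq> I" for J using that card_mono[OF I that] by simp
  have "rainbow_count V col J (f J) = 1" if "J \<subseteq> I" for J
    using finite_subset[OF that I] that
  proof (induction J rule: finite_induct)
    case empty
    have "{s. s \<subseteq> V \<and> rainbow col {} s} = {{}}" by (auto simp: rainbow_def)
    then show ?case using f[of "{}"] by (simp add: rainbow_count_def good_def)
  next
    case (insert i J)
    let ?K = "insert i J"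
    have K: "?K - {i} = J" using insert.hyps by auto
    have sub: "mod2_chains (?C L) k \<subseteq> mod2_chains {s. s \<subseteq> V \<and> col ` s \<subseteq> L} k" for L k
    proof
      fix c assume "c \<in> mod2_chains (?C L) k"
      then show "c \<in> mod2_chains {s. s \<subseteq> V \<and> col ` s \<subseteq> L} k"
        by (rule mod2_chains_mono) (use V in auto)
    qed
    \<comment> \<open>\<open>f (?K - {j})\<close> uses no face with colour \<open>j\<close>, so of
      the facets of \<open>?K\<close> only \<open>J\<close> itself contributes to the count.\<close>
    have zero: "rainbow_count V col J (f (?K - {j})) = 0" if j: "j \<in> J" for j
      unfolding rainbow_count_def
    proof (rule sum.neutral, intro ballI)
      fix s assume "s \<in> {s. s \<subseteq> V \<and> rainbow col J s}"
      then have "j \<in> col ` s" using j by (simp add: rainbow_def)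
      moreover have "f (?K - {j}) \<in> mod2_chains (?C (?K - {j})) (card (?K - {j}))"
        using f[of "?K - {j}"] insert.prems by (auto simp: good_def)
      ultimately show "f (?K - {j}) s = 0" by (auto simp: mod2_chains_def)
    qed
    have fK: "f ?K \<in> mod2_chains (?C ?K) (card ?K)"
      using f[OF insert.prems] by (simp add: good_def)
    have "rainbow_count V col (?K - {i}) (boundary V (f ?K)) = rainbow_count V col ?K (f ?K)"
      by (rule rainbow_count_boundary[OF V(1) subsetD[OF sub fK]]) (use insert.hyps in auto)
    then have "rainbow_count V col ?K (f ?K) = rainbow_count V col J (boundary V (f ?K))"
      by (simp only: K)
    also have "boundary V (f ?K) = (\<lambda>s. \<Sum>j\<in>?K. f (?K - {j}) s)"
      using f[OF insert.prems] by (simp add: good_def)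
    also have "rainbow_count V col J \<dots> = (\<Sum>j\<in>?K. rainbow_count V col J (f (?K - {j})))"
      unfolding rainbow_count_def by (rule sum.swap)
    also have "\<dots> = rainbow_count V col J (f J)" using insert.hyps zero K by simp
    finally show ?case using insert by simp
  qed
  then have "rainbow_count V col I (f I) \<noteq> 0" by simp
  then obtain s where "rainbow col I s" "f I s \<noteq> 0"
    unfolding rainbow_count_def by (metis (mono_tags, lifting) mem_Collect_eq sum.neutral)
  then show ?thesis using f[of I] by (auto simp: good_def mod2_chains_def)
qed

section \<open>Matroids with loops\<close>

definition mrank :: "'a set set \<Rightarrow> 'a set \<Rightarrow> nat" where
  "mrank M A = Max (card ` {I \<in> M. I \<subseteq> A})"

text \<open>The elements of \<open>D\<close> stay in the ground set as loops, so weights and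
  homology before and after a contraction live on the same \<open>V\<close>.\<close>

definition contract :: "'a set set \<Rightarrow> 'a set \<Rightarrow> 'a set set" where
  "contract M D = {S. S \<inter> D = {} \<and> S \<union> D \<in> M}"

text \<open>Unlike in the definition \<open>matroid_on\<close>, elements of \<open>V\<close> may be loops here, because
  contractions create loops.\<close>

locale loopy_matroid =
  fixes V :: "'a set" and M :: "'a set set"
  assumes finite_ground: "finite V"
    and indep_subset_ground: "S \<in> M \<Longrightarrow> S \<subseteq> V"
    and empty_indep: "{} \<in> M"
    and indep_subset: "S \<in> M \<Longrightarrow> T \<subseteq> S \<Longrightarrow> T \<in> M"
    and augment: "S \<in> M \<Longrightarrow> T \<in> M \<Longrightarrow> card S < card T \<Longrightarrow> \<exists>v\<in>T - S. insert v S \<in> M"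
begin

lemma finite_indep: "S \<in> M \<Longrightarrow> finite S"
  using finite_ground indep_subset_ground finite_subset by blast

lemma finite_cards: "finite (card ` {I \<in> M. I \<subseteq> A})"
proof -
  have "M \<subseteq> Pow V" using indep_subset_ground by auto
  then have "finite M" using finite_ground finite_subset by blast
  then show ?thesis by simp
qed

lemma card_le_mrank: "I \<in> M \<Longrightarrow> I \<subseteq> A \<Longrightarrow> card I \<le> mrank M A"
  unfolding mrank_def using finite_cards by (intro Max_ge) auto

lemma mrank_attained: "\<exists>I\<in>M. I \<subseteq> A \<and> card I = mrank M A"
proof -
  have "card ` {I \<in> M. I \<subseteq> A} \<noteq> {}" using empty_indep by auto
  then have "mrank M A \<in> card ` {I \<in> M. I \<subseteq> A}"
    unfolding mrank_def using finite_cards Max_in by blast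
  then show ?thesis by auto
qed

lemma mrank_empty: "mrank M {} = 0"
  using mrank_attained[of "{}"] by auto

lemma mrank_singleton: "mrank M {v} \<le> 1"
proof -
  obtain I where "I \<subseteq> {v}" "card I = mrank M {v}" using mrank_attained by blast
  then show ?thesis using card_mono[of "{v}" I] by simp
qed

lemma mrank_mono: "A \<subseteq> B \<Longrightarrow> mrank M A \<le> mrank M B"
  using mrank_attained[of A] card_le_mrank by (metis subset_trans)

lemma extend_to_basis:
  assumes "I \<in> M" "I \<subseteq> A"
  shows "\<exists>J\<in>M. I \<subseteq> J \<and> J \<subseteq> A \<and> card J = mrank M A"
  using assms
proof (induction "mrank M A - card I" arbitrary: I rule: less_induct)
  case less
  show ?case
  proof (cases "card I = mrank M A")
    case True then show ?thesis using less by blast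
  next
    case False
    obtain B where B: "B \<in> M" "B \<subseteq> A" "card B = mrank M A" using mrank_attained by blast
    have "card I < mrank M A" using False card_le_mrank[OF less.prems] by simp
    then obtain v where v: "v \<in> B - I" "insert v I \<in> M" using augment[OF less.prems(1) B(1)] B by auto
    have "card (insert v I) = Suc (card I)" using v finite_indep[OF less.prems(1)] by auto
    then have "mrank M A - card (insert v I) < mrank M A - card I"
      using \<open>card I < mrank M A\<close> by simp
    then obtain J where "J \<in> M" "insert v I \<subseteq> J" "J \<subseteq> A" "card J = mrank M A"
      using less.hyps[of "insert v I"] v B less.prems by blast
    then show ?thesis by blast
  qed
qed

text \<open>A basis \<open>I\<close> of the intersection extends to a basis \<open>J\<close> of the
  union; count the traces of \<open>J\<close> on \<open>A\<close> and \<open>B\<close>.\<close>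

lemma mrank_submodular: "mrank M (A \<union> B) + mrank M (A \<inter> B) \<le> mrank M A + mrank M B"
proof -
  obtain I where I: "I \<in> M" "I \<subseteq> A \<inter> B" "card I = mrank M (A \<inter> B)" using mrank_attained by blast
  then obtain J where J: "J \<in> M" "I \<subseteq> J" "J \<subseteq> A \<union> B" "card J = mrank M (A \<union> B)"
    using extend_to_basis[of I "A \<union> B"] by blast
  have fin: "finite J" using J finite_indep by simp
  have "J = (J \<inter> A) \<union> (J \<inter> B)" using J by auto
  then have "card J + card ((J \<inter> A) \<inter> (J \<inter> B)) = card (J \<inter> A) + card (J \<inter> B)"
    using card_Un_Int[of "J \<inter> A" "J \<inter> B"] fin by simp
  moreover have "card I \<le> card ((J \<inter> A) \<inter> (J \<inter> B))" using I J fin by (intro card_mono) auto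
  moreover have "card (J \<inter> A) \<le> mrank M A" "card (J \<inter> B) \<le> mrank M B"
    using J indep_subset[of J] by (auto intro!: card_le_mrank)
  ultimately show ?thesis using I J by simp
qed

lemma mrank_contract:
  assumes "D \<in> M"
  shows "mrank M (A \<union> D) \<le> mrank (contract M D) A + card D"
proof -
  obtain J where J: "J \<in> M" "D \<subseteq> J" "J \<subseteq> A \<union> D" "card J = mrank M (A \<union> D)"
    using extend_to_basis[of D "A \<union> D"] assms by blast
  have "J - D \<in> contract M D" using J by (auto simp: contract_def Un_absorb2)
  moreover have "finite (card ` {I \<in> contract M D. I \<subseteq> A})"
  proof -
    have "contract M D \<subseteq> Pow V" unfolding contract_def using indep_subset_ground by blast
    then have "finite (contract M D)" using finite_ground finite_subset by blast
    then show ?thesis by simp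
  qed
  ultimately have "card (J - D) \<le> mrank (contract M D) A"
    unfolding mrank_def using J by (intro Max_ge) auto
  moreover have "card J = card (J - D) + card D"
    using J finite_indep by (metis card_Diff_subset card_mono finite_subset le_add_diff_inverse2)
  ultimately show ?thesis using J by simp
qed

lemma loopy_matroid_contract:
  assumes D: "D \<in> M"
  shows "loopy_matroid V (contract M D)"
proof
  show "finite V" by (rule finite_ground)
  fix S T
  show "S \<subseteq> V" if "S \<in> contract M D" using that indep_subset_ground by (auto simp: contract_def)
  show "{} \<in> contract M D" using D by (simp add: contract_def)
  show "T \<in> contract M D" if "S \<in> contract M D" "T \<subseteq> S"
  proof -
    have "S \<union> D \<in> M" "S \<inter> D = {}" using that by (auto simp: contract_def)
    then show ?thesis using that indep_subset[of "S \<union> D" "T \<union> D"] by (auto simp: contract_def)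
  qed
  show "\<exists>v\<in>T - S. insert v S \<in> contract M D"
    if "S \<in> contract M D" "T \<in> contract M D" "card S < card T"
  proof -
    have *: "S \<union> D \<in> M" "S \<inter> D = {}" "T \<union> D \<in> M" "T \<inter> D = {}"
      using that by (auto simp: contract_def)
    then have "card (S \<union> D) < card (T \<union> D)"
      using that(3) finite_indep[of "S \<union> D"] finite_indep[of "T \<union> D"] by (simp add: card_Un_disjoint)
    then obtain v where "v \<in> (T \<union> D) - (S \<union> D)" "insert v (S \<union> D) \<in> M"
      using augment * by blast
    then show ?thesis using * by (intro bexI[of _ v]) (auto simp: contract_def)
  qed
qed

text \<open>\<open>insert v D\<close> and \<open>insert v E\<close> are distinct circuits through
  \<open>v\<close>. Submodularity bounds the ranks of their union and intersection together by
  \<open>card D + card E\<close>, whereas independence of \<open>D \<union> E\<close> and of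
  \<open>insert v (D \<inter> E)\<close> forces at least one more.\<close>

lemma two_circuits:
  assumes D: "D \<noteq> E" "v \<notin> D" "v \<notin> E" and DE: "D \<union> E \<in> M"
    and "insert v D \<notin> M" "insert v E \<notin> M"
    and minD: "\<And>u. u \<in> D \<Longrightarrow> insert v (D - {u}) \<in> M"
    and minE: "\<And>u. u \<in> E \<Longrightarrow> insert v (E - {u}) \<in> M"
  shows False
proof -
  have fin: "finite D" "finite E" using finite_indep[OF DE] by auto
  have rank: "mrank M (insert v X) \<le> card X" if "finite X" "v \<notin> X" "insert v X \<notin> M" for X
  proof -
    obtain I where I: "I \<in> M" "I \<subseteq> insert v X" "card I = mrank M (insert v X)"
      using mrank_attained by blast
    then have "I \<subset> insert v X" using that by blast
    then have "card I < card (insert v X)" using that by (intro psubset_card_mono) auto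
    then show ?thesis using that I by simp
  qed
  have "insert v (D \<inter> E) \<in> M"
  proof (cases "D \<subseteq> E")
    case True
    then obtain u where "u \<in> E" "u \<notin> D" using D by blast
    then show ?thesis using minE indep_subset[of "insert v (E - {u})" "insert v (D \<inter> E)"] by blast
  next
    case False
    then obtain u where "u \<in> D" "u \<notin> E" by blast
    then show ?thesis using minD indep_subset[of "insert v (D - {u})" "insert v (D \<inter> E)"] by blast
  qed
  then have "Suc (card (D \<inter> E)) \<le> mrank M (insert v (D \<inter> E))"
    using card_le_mrank[of "insert v (D \<inter> E)" "insert v (D \<inter> E)"] fin D by simp
  moreover have "card (D \<union> E) \<le> mrank M (insert v (D \<union> E))"
    using DE by (intro card_le_mrank) auto
  moreover have "card (D \<union> E) + card (D \<inter> E) = card D + card E"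
    using card_Un_Int[OF fin] by simp
  ultimately show False
    using mrank_submodular[of "insert v D" "insert v E"] rank[of D] rank[of E] fin assms
    by (simp add: insert_commute)
qed

end

section \<open>Fractional vectors bounded by a rank function\<close>

lemma homogeneous_system_nontrivial_solution:
  fixes c :: "'e \<Rightarrow> 'a \<Rightarrow> real"
  assumes "finite E" "finite U" "card E < card U"
  shows "\<exists>z. (\<exists>u\<in>U. z u \<noteq> 0) \<and> (\<forall>e\<in>E. (\<Sum>u\<in>U. c e u * z u) = 0)"
  using assms
proof (induction E arbitrary: U c rule: finite_induct)
  case empty
  then have "U \<noteq> {}" by auto
  then show ?case by (intro exI[of _ "\<lambda>_. 1"]) auto
next
  case (insert e E)
  show ?case
  proof (cases "\<forall>u\<in>U. c e u = 0")
    case True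
    obtain z where "\<exists>u\<in>U. z u \<noteq> 0" "\<forall>e\<in>E. (\<Sum>u\<in>U. c e u * z u) = 0"
      using insert.IH[of U c] insert.prems insert.hyps by auto
    then show ?thesis using True by (intro exI[of _ z]) simp
  next
    case False
    then obtain w where w: "w \<in> U" "c e w \<noteq> 0" by blast
    let ?U = "U - {w}"
    \<comment> \<open>Gaussian elimination: equation \<open>e\<close> is solved for the unknown
      \<open>w\<close>, and \<open>d\<close> holds the coefficients after substitution.\<close>
    define d where "d f u = c f u - c f w * c e u / c e w" for f u
    have "card E < card ?U" using insert.prems insert.hyps w by simp
    then obtain z where z: "\<exists>u\<in>?U. z u \<noteq> 0" "\<forall>f\<in>E. (\<Sum>u\<in>?U. d f u * z u) = 0"
      using insert.IH[of ?U d] insert.prems by auto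
    define a where "a = - (\<Sum>u\<in>?U. c e u * z u) / c e w"
    define y where "y = z(w := a)"
    have split: "(\<Sum>u\<in>U. c f u * y u) = c f w * a + (\<Sum>u\<in>?U. c f u * z u)" for f
    proof -
      have "(\<Sum>u\<in>U. c f u * y u) = c f w * y w + (\<Sum>u\<in>?U. c f u * y u)"
        using insert.prems w by (simp add: sum.remove)
      moreover have "(\<Sum>u\<in>?U. c f u * y u) = (\<Sum>u\<in>?U. c f u * z u)"
        by (intro sum.cong) (auto simp: y_def)
      ultimately show ?thesis by (simp add: y_def)
    qed
    have "(\<Sum>u\<in>U. c f u * y u) = 0" if f: "f \<in> insert e E" for f
    proof (cases "f = e")
      case True then show ?thesis unfolding split using w by (simp add: a_def)
    next
      case False
      then have "0 = (\<Sum>u\<in>?U. d f u * z u)" using f z(2) by simp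
      also have "\<dots> = (\<Sum>u\<in>?U. c f u * z u) - c f w / c e w * (\<Sum>u\<in>?U. c e u * z u)"
        unfolding d_def by (simp add: algebra_simps sum_subtractf sum_distrib_left sum_divide_distrib)
      also have "\<dots> = (\<Sum>u\<in>U. c f u * y u)" unfolding split a_def by simp
      finally show ?thesis by simp
    qed
    moreover have "\<exists>u\<in>U. y u \<noteq> 0" using z(1) by (auto simp: y_def)
    ultimately show ?thesis by (intro exI[of _ y]) blast
  qed
qed

text \<open>Each block will impose one equation, so a family contributes at most half as many
  equations as there are unknowns.\<close>

lemma card_disjoint_pairs:
  assumes "finite U" "\<And>P. P \<in> \<A> \<Longrightarrow> P \<subseteq> U \<and> 2 \<le> card P" "pairwise disjnt \<A>"
  shows "2 * card \<A> \<le> card (\<Union>\<A>)" "\<Union>\<A> \<subseteq> U" "finite \<A>"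
proof -
  show sub: "\<Union>\<A> \<subseteq> U" using assms(2) by blast
  then have "\<A> \<subseteq> Pow U" by blast
  then show fin: "finite \<A>" using assms(1) finite_subset by blast
  have "card (\<Union>\<A>) = (\<Sum>P\<in>\<A>. card P)"
    using assms finite_subset by (intro card_Union_disjoint) blast+
  moreover have "(\<Sum>P\<in>\<A>. 2) \<le> (\<Sum>P\<in>\<A>. card P)" using assms(2) by (intro sum_mono) blast
  ultimately show "2 * card \<A> \<le> card (\<Union>\<A>)" by simp
qed

text \<open>There are at most as many equations as unknowns, and in case of equality both families
  partition \<open>U\<close>, which makes one equation redundant.\<close>

lemma exists_balanced_vector:
  assumes U: "finite U" "U \<noteq> {}"
    and A: "\<And>P. P \<in> \<A> \<Longrightarrow> P \<subseteq> U \<and> 2 \<le> card P" "pairwise disjnt \<A>"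
    and B: "\<And>P. P \<in> \<B> \<Longrightarrow> P \<subseteq> U \<and> 2 \<le> card P" "pairwise disjnt \<B>"
  shows "\<exists>z :: 'a \<Rightarrow> real. (\<exists>u\<in>U. z u \<noteq> 0) \<and> (\<forall>v. v \<notin> U \<longrightarrow> z v = 0) \<and> (\<forall>P\<in>\<A> \<union> \<B>. sum z P = 0)"
proof -
  note cA = card_disjoint_pairs[OF U(1) A] and cB = card_disjoint_pairs[OF U(1) B]
  have solve: "\<exists>z :: 'a \<Rightarrow> real. (\<exists>u\<in>U. z u \<noteq> 0) \<and> (\<forall>v. v \<notin> U \<longrightarrow> z v = 0) \<and> (\<forall>P\<in>E. sum z P = 0)"
    if E: "E \<subseteq> \<A> \<union> \<B>" "card E < card U" for E
  proof -
    have "finite E" using E cA cB finite_subset by blast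
    from homogeneous_system_nontrivial_solution[OF this U(1) E(2),
        of "\<lambda>P u. if u \<in> P then 1 else 0"]
    obtain z :: "'a \<Rightarrow> real" where z: "\<exists>u\<in>U. z u \<noteq> 0"
      "\<forall>P\<in>E. (\<Sum>u\<in>U. (if u \<in> P then 1 else 0) * z u) = 0" by blast
    let ?z = "\<lambda>u. if u \<in> U then z u else 0"
    have "sum ?z P = 0" if "P \<in> E" for P
    proof -
      have P: "P \<subseteq> U" using that E A B by blast
      have "sum ?z P = (\<Sum>u\<in>U. (if u \<in> P then 1 else 0) * z u)"
        using P U by (intro sum.mono_neutral_cong_left) auto
      then show ?thesis using z that by simp
    qed
    then show ?thesis using z(1) by (intro exI[of _ ?z]) auto
  qed
  have le: "card (\<Union>\<A>) \<le> card U" "card (\<Union>\<B>) \<le> card U"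
    using cA cB U by (auto intro: card_mono)
  show ?thesis
  proof (cases "\<Union>\<A> = U \<and> \<Union>\<B> = U")
    case False
    then have "card (\<Union>\<A>) < card U \<or> card (\<Union>\<B>) < card U"
      using cA(2) cB(2) U(1) psubset_card_mono[of U] by blast
    then have "card (\<A> \<union> \<B>) < card U"
      using cA(1) cB(1) le card_Un_le[of \<A> \<B>] by linarith
    then show ?thesis using solve[of "\<A> \<union> \<B>"] by simp
  next
    case True
    then obtain Q where Q: "Q \<in> \<B>" using U by auto
    have "card (\<B> - {Q}) < card \<B>" using Q cB(3) by (rule card_Diff1_less[rotated])
    then have "card (\<A> \<union> (\<B> - {Q})) < card U"
      using cA(1) cB(1) le card_Un_le[of \<A> "\<B> - {Q}"] by linarith
    from solve[OF _ this] obtain z :: "'a \<Rightarrow> real" where z: "\<exists>u\<in>U. z u \<noteq> 0" "\<forall>v. v \<notin> U \<longrightarrow> z v = 0"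
      "\<forall>P\<in>\<A> \<union> (\<B> - {Q}). sum z P = 0" by blast
    have sumU: "sum z (\<Union>\<C>) = (\<Sum>P\<in>\<C>. sum z P)"
      if "\<And>P. P \<in> \<C> \<Longrightarrow> P \<subseteq> U" "pairwise disjnt \<C>" for \<C>
    proof -
      have "\<forall>P\<in>\<C>. finite P" using that(1) U finite_subset by blast
      moreover have "\<forall>P\<in>\<C>. \<forall>P'\<in>\<C>. P \<noteq> P' \<longrightarrow> P \<inter> P' = {}"
        using that(2) by (auto simp: pairwise_def disjnt_def)
      ultimately show ?thesis by (simp add: sum.Union_disjoint)
    qed
    \<comment> \<open>The blocks of \<open>\<A>\<close> show that the total is zero, so the equation
      of \<open>Q\<close> follows from those of the other blocks of \<open>\<B>\<close>.\<close>
    have "sum z U = 0" using sumU[of \<A>] A True z by simp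
    moreover have "sum z U = sum z Q + (\<Sum>P\<in>\<B> - {Q}. sum z P)"
      using sumU[of \<B>] B True Q cB(3) by (simp add: sum.remove)
    ultimately have "sum z Q = 0" using z(3) by simp
    then have "\<forall>P\<in>\<A> \<union> \<B>. sum z P = 0" using z(3) by blast
    then show ?thesis using z by blast
  qed
qed

text \<open>A ratio test: \<open>s\<close> is the slack of a constraint and \<open>d\<close> the
  rate at which it shrinks. A constraint without slack does not move, so the first hitting time is
  positive.\<close>

lemma first_hit:
  fixes I :: "(real \<times> real) set"
  assumes I: "finite I" and s: "\<And>s d. (s, d) \<in> I \<Longrightarrow> 0 \<le> s \<and> (s = 0 \<longrightarrow> d = 0)"
    and ex: "\<exists>(s, d)\<in>I. 0 < d"
  shows "\<exists>t. (\<forall>(s, d)\<in>I. t * d \<le> s) \<and> (\<exists>(s, d)\<in>I. 0 < s \<and> t * d = s) \<and> 0 < t"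
proof -
  let ?J = "{(s, d) \<in> I. 0 < d}"
  let ?R = "(\<lambda>(s, d). s / d) ` ?J"
  have fin: "finite ?R" using I by (auto intro: finite_subset)
  have "?R \<noteq> {}" using ex by auto
  then have "Min ?R \<in> ?R" using fin Min_in by blast
  then obtain s0 d0 where sd: "(s0, d0) \<in> I" "0 < d0" "Min ?R = s0 / d0" by auto
  have pos: "0 < s0" using s[OF sd(1)] sd(2) by force
  have "s0 / d0 * d \<le> s" if "(s, d) \<in> I" for s d
  proof (cases "0 < d")
    case True
    then have "s0 / d0 \<le> s / d" using that fin Min_le[OF fin, of "s / d"] sd(3) by force
    then show ?thesis using True by (simp add: field_simps)
  next
    case False
    then have "s0 / d0 * d \<le> 0" using pos sd(2) by (intro mult_nonneg_nonpos) auto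
    then show ?thesis using s[OF that] by linarith
  qed
  then show ?thesis using sd pos by (intro exI[of _ "s0 / d0"]) force
qed

text \<open>For \<open>p > 0\<close> this is Edmonds' description of the independent set polytope of
  \<open>M\<close>, scaled by \<open>p\<close>.\<close>

definition feasible :: "'a set \<Rightarrow> 'a set set \<Rightarrow> real \<Rightarrow> ('a \<Rightarrow> real) \<Rightarrow> bool" where
  "feasible V M p x \<longleftrightarrow> (\<forall>v\<in>V. 0 \<le> x v) \<and> (\<forall>A\<subseteq>V. sum x A \<le> p * real (mrank M A))"

definition tight :: "'a set \<Rightarrow> 'a set set \<Rightarrow> real \<Rightarrow> ('a \<Rightarrow> real) \<Rightarrow> 'a set \<Rightarrow> bool" where
  "tight V M p x A \<longleftrightarrow> A \<subseteq> V \<and> sum x A = p * real (mrank M A)"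

lemma feasible_nonneg: "feasible V M p x \<Longrightarrow> v \<in> V \<Longrightarrow> 0 \<le> x v"
  by (simp add: feasible_def)

lemma feasible_sum_le: "feasible V M p x \<Longrightarrow> A \<subseteq> V \<Longrightarrow> sum x A \<le> p * real (mrank M A)"
  by (simp add: feasible_def)

lemma feasible_mono:
  assumes "feasible V M p x" "\<And>v. v \<in> V \<Longrightarrow> 0 \<le> y v" "\<And>v. v \<in> V \<Longrightarrow> y v \<le> x v"
  shows "feasible V M p y"
  unfolding feasible_def
proof (intro conjI ballI allI impI)
  fix A assume A: "A \<subseteq> V"
  then have "sum y A \<le> sum x A" using assms(3) by (intro sum_mono) blast
  also have "\<dots> \<le> p * real (mrank M A)" by (rule feasible_sum_le[OF assms(1) A])
  finally show "sum y A \<le> p * real (mrank M A)" .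
qed (rule assms(2))

section \<open>Tight sets, truncation and contraction of weights\<close>

context loopy_matroid
begin

lemma mrank_loop:
  assumes "{v} \<notin> M"
  shows "mrank M {v} = 0"
proof -
  obtain I where I: "I \<in> M" "I \<subseteq> {v}" "card I = mrank M {v}" using mrank_attained by blast
  then have "I = {}" using assms subset_singletonD[of I v] by auto
  then show ?thesis using I(3) by simp
qed

lemma feasible_le:
  assumes "feasible V M p x" "v \<in> V" "0 < p"
  shows "x v \<le> p"
proof -
  have "x v \<le> p * real (mrank M {v})" using feasible_sum_le[OF assms(1), of "{v}"] assms(2) by simp
  also have "\<dots> \<le> p * 1" using mrank_singleton[of v] assms(3) by (intro mult_left_mono) auto
  finally show ?thesis by simp
qed

lemma feasible_loop:
  assumes "feasible V M p x" "v \<in> V" "{v} \<notin> M"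
  shows "x v = 0"
  using feasible_sum_le[OF assms(1), of "{v}"] feasible_nonneg[OF assms(1,2)] assms(2)
    mrank_loop[OF assms(3)] by simp

text \<open>Sums are modular and rank is submodular, which leaves no slack at the union and the
  intersection.\<close>

lemma tight_uncross:
  assumes x: "feasible V M p x" and p: "0 < p" and "tight V M p x A" "tight V M p x B"
  shows "tight V M p x (A \<union> B)" "tight V M p x (A \<inter> B)"
proof -
  have AB: "A \<subseteq> V" "B \<subseteq> V" "sum x A = p * mrank M A" "sum x B = p * mrank M B"
    using assms by (auto simp: tight_def)
  have "sum x (A \<union> B) + sum x (A \<inter> B) = sum x A + sum x B"
    using AB(1,2)[THEN finite_subset[OF _ finite_ground]] by (rule sum.union_inter)
  moreover have "sum x (A \<union> B) \<le> p * mrank M (A \<union> B)" "sum x (A \<inter> B) \<le> p * mrank M (A \<inter> B)"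
    using feasible_sum_le[OF x, of "A \<union> B"] feasible_sum_le[OF x, of "A \<inter> B"] AB(1,2)
    by (simp_all add: le_infI1)
  moreover have "p * mrank M (A \<union> B) + p * mrank M (A \<inter> B) \<le> p * mrank M A + p * mrank M B"
  proof -
    have "real (mrank M (A \<union> B)) + real (mrank M (A \<inter> B)) \<le> real (mrank M A) + real (mrank M B)"
      using mrank_submodular[of A B] by linarith
    from mult_left_mono[OF this, of p] show ?thesis using p by (simp add: distrib_left)
  qed
  ultimately have "sum x (A \<union> B) = p * mrank M (A \<union> B)" "sum x (A \<inter> B) = p * mrank M (A \<inter> B)"
    using AB by linarith+
  then show "tight V M p x (A \<union> B)" "tight V M p x (A \<inter> B)" using AB by (auto simp: tight_def)
qed

lemma tight_empty: "tight V M p x {}"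
  by (simp add: tight_def mrank_empty)

lemma finite_tight: "finite {A. tight V M p x A}"
  by (rule finite_subset[of _ "Pow V"]) (auto simp: tight_def finite_ground)

lemma least_tight:
  assumes x: "feasible V M p x" and p: "0 < p" and A0: "tight V M p x A0" "u \<in> A0"
  shows "\<exists>A. tight V M p x A \<and> u \<in> A \<and> (\<forall>B. tight V M p x B \<longrightarrow> u \<in> B \<longrightarrow> A \<subseteq> B)"
proof -
  let ?F = "{A. tight V M p x A \<and> u \<in> A}"
  have fin: "finite ?F" using finite_tight[of p x] by (rule rev_finite_subset) auto
  have "?F \<noteq> {}" using A0 by auto
  from finite_has_minimal[OF fin this] obtain A where A: "A \<in> ?F" and min: "\<forall>B\<in>?F. B \<le> A \<longrightarrow> A = B" ..
  have "A \<subseteq> B" if "tight V M p x B" "u \<in> B" for B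
  proof -
    have "A \<inter> B \<in> ?F" using tight_uncross(2)[OF x p _ that(1), of A] A that(2) by simp
    then have "A = A \<inter> B" by (rule min[rule_format]) (rule Int_lower1)
    then show ?thesis by (rule inf.orderI)
  qed
  then show ?thesis using A by auto
qed

text \<open>The predicate \<open>Q\<close> covers two uses: tight sets that avoid a given element,
  and all tight sets.\<close>

lemma greatest_tight:
  assumes x: "feasible V M p x" and p: "0 < p"
    and Q: "Q {}" "\<And>A B. Q A \<Longrightarrow> Q B \<Longrightarrow> Q (A \<union> B)"
  shows "\<exists>A. tight V M p x A \<and> Q A \<and> (\<forall>B. tight V M p x B \<longrightarrow> Q B \<longrightarrow> B \<subseteq> A)"
proof -
  let ?F = "{A. tight V M p x A \<and> Q A}"
  have fin: "finite ?F" using finite_tight[of p x] by (rule rev_finite_subset) auto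
  have "?F \<noteq> {}" using tight_empty Q(1) by auto
  from finite_has_maximal[OF fin this] obtain A where A: "A \<in> ?F" and max: "\<forall>B\<in>?F. A \<le> B \<longrightarrow> A = B" ..
  have "B \<subseteq> A" if "tight V M p x B" "Q B" for B
  proof -
    have "A \<union> B \<in> ?F" using tight_uncross(1)[OF x p _ that(1), of A] A that(2) Q(2) by simp
    then have "A = A \<union> B" by (rule max[rule_format]) (rule Un_upper1)
    then show ?thesis by (rule sup.orderI)
  qed
  then show ?thesis using A by auto
qed

text \<open>The classes are the atoms of the lattice of tight sets. Each has weight a positive multiple
  of \<open>p\<close>, so it cannot be a singleton.\<close>

lemma tight_partition:
  fixes x :: "'a \<Rightarrow> real"
  assumes x: "feasible V M p x" and p: "0 < p" and less: "\<And>v. v \<in> V \<Longrightarrow> x v < p"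
  defines "U \<equiv> {v \<in> V. 0 < x v}"
  shows "\<exists>\<A>. (\<forall>P\<in>\<A>. P \<subseteq> U \<and> 2 \<le> card P) \<and> pairwise disjnt \<A> \<and>
    (\<forall>(z :: 'a \<Rightarrow> real) A. (\<forall>v. v \<notin> U \<longrightarrow> z v = 0) \<longrightarrow> (\<forall>P\<in>\<A>. sum z P = 0) \<longrightarrow>
      tight V M p x A \<longrightarrow> sum z A = 0)"
proof -
  let ?T = "tight V M p x"
  \<comment> \<open>\<open>cls u\<close> collects the elements of the support that no tight set
    separates from \<open>u\<close>.\<close>
  define cls where "cls u = {w \<in> U. \<forall>A. ?T A \<longrightarrow> (u \<in> A \<longleftrightarrow> w \<in> A)}" for u
  define \<A> where "\<A> = cls ` {u \<in> U. \<exists>A. ?T A \<and> u \<in> A}"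
  have finU: "finite U" unfolding U_def using finite_ground by simp
  have big: "2 \<le> card (cls u)" if u: "u \<in> U" and A0: "?T A0" "u \<in> A0" for u A0
  proof -
    obtain A where A: "?T A" "u \<in> A" and 1: "\<And>B. ?T B \<Longrightarrow> u \<in> B \<Longrightarrow> A \<subseteq> B"
      using least_tight[OF x p A0] by blast
    obtain K where K: "?T K" "u \<notin> K" and 2: "\<And>B. ?T B \<Longrightarrow> u \<notin> B \<Longrightarrow> B \<subseteq> K"
      using greatest_tight[OF x p, of "\<lambda>A. u \<notin> A"] by blast
    \<comment> \<open>\<open>A\<close> is the least tight set containing \<open>u\<close> and
      \<open>K\<close> the greatest one avoiding it, so the weight of the class is a difference of
      two tight values.\<close>
    have cls: "cls u = U \<inter> (A - K)"
    proof (intro subset_antisym subsetI)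
      show "w \<in> U \<inter> (A - K)" if "w \<in> cls u" for w
        using that A K by (simp add: cls_def)
    next
      fix w assume w: "w \<in> U \<inter> (A - K)"
      have "u \<in> B \<longleftrightarrow> w \<in> B" if "?T B" for B using w 1[OF that] 2[OF that] by blast
      then show "w \<in> cls u" using w by (simp add: cls_def)
    qed
    have AV: "A \<subseteq> V" using A by (simp add: tight_def)
    have finA: "finite A" using AV finite_ground finite_subset by blast
    have "sum x (cls u) = sum x (A - K)"
      unfolding cls
    proof (rule sum.mono_neutral_left)
      show "\<forall>w\<in>A - K - U \<inter> (A - K). x w = 0"
        using AV feasible_nonneg[OF x] by (force simp: U_def)
    qed (use finA in auto)
    also have "A - K = A - A \<inter> K" by blast
    also have "sum x (A - A \<inter> K) = sum x A - sum x (A \<inter> K)"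
      using finA by (intro sum_diff) auto
    also have "\<dots> = p * (real (mrank M A) - real (mrank M (A \<inter> K)))"
      using A(1) tight_uncross(2)[OF x p A(1) K(1)] by (simp add: tight_def algebra_simps)
    finally have sum: "sum x (cls u) = p * (real (mrank M A) - real (mrank M (A \<inter> K)))" .
    have ucls: "u \<in> cls u" using u by (simp add: cls_def)
    have fincls: "finite (cls u)" using finU by (simp add: cls_def)
    have "0 < x u" using u by (simp add: U_def)
    also have "x u \<le> sum x (cls u)"
      using ucls fincls by (intro member_le_sum) (auto simp: cls_def U_def)
    finally have "mrank M (A \<inter> K) < mrank M A" using p unfolding sum by (simp add: zero_less_mult_iff)
    \<comment> \<open>Ranks are integers, so the class weighs at least \<open>p\<close>, more than
      any single element.\<close>
    then have "1 \<le> real (mrank M A) - real (mrank M (A \<inter> K))" by linarith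
    from mult_left_mono[OF this, of p] have le: "p \<le> sum x (cls u)" unfolding sum using p by simp
    have "cls u \<noteq> {u}" using le less[of u] u by (auto simp: U_def)
    then have "card (cls u) \<noteq> 1" using ucls by (metis card_1_singletonE singletonD)
    moreover have "card (cls u) \<noteq> 0" using ucls fincls by auto
    ultimately show ?thesis by linarith
  qed
  have eq: "cls u = cls w" if "w \<in> cls u" for u w
    using that unfolding cls_def by blast
  have "P \<subseteq> U \<and> 2 \<le> card P" if "P \<in> \<A>" for P
    using that unfolding \<A>_def using big by (auto simp: cls_def)
  moreover have "pairwise disjnt \<A>"
    unfolding pairwise_def disjnt_def \<A>_def using eq by blast
  moreover have "sum z A = 0"
    if z: "\<forall>v. v \<notin> U \<longrightarrow> z v = 0" "\<forall>P\<in>\<A>. sum z P = 0" and A: "?T A" for z :: "'a \<Rightarrow> real" and A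
  proof -
    have finA: "finite A" using A finite_ground finite_subset by (auto simp: tight_def)
    \<comment> \<open>Within the support a tight set is a union of whole classes.\<close>
    have fib: "{w \<in> A \<inter> U. cls w = P} = P" if P: "P \<in> cls ` (A \<inter> U)" for P
    proof -
      obtain u where u: "u \<in> A" "u \<in> U" "P = cls u" using P by blast
      have "w \<in> cls w" if "w \<in> U" for w using that by (simp add: cls_def)
      moreover have "w \<in> A" if "w \<in> cls u" for w using that A u by (simp add: cls_def)
      moreover have "cls u \<subseteq> U" by (auto simp: cls_def)
      ultimately show ?thesis using eq u by blast
    qed
    have "sum z A = sum z (A \<inter> U)" using finA z(1) by (intro sum.mono_neutral_right) auto
    also have "\<dots> = (\<Sum>P\<in>cls ` (A \<inter> U). sum z {w \<in> A \<inter> U. cls w = P})"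
      using finA by (intro sum.group[symmetric]) auto
    also have "\<dots> = (\<Sum>P\<in>cls ` (A \<inter> U). sum z P)" using fib by (intro sum.cong) auto
    also have "\<dots> = 0" using z(2) A by (intro sum.neutral) (auto simp: \<A>_def)
    finally show ?thesis .
  qed
  ultimately show ?thesis by (intro exI[of _ \<A>] conjI ballI allI impI) simp_all
qed

text \<open>Raise the coordinates greedily from zero, each until it reaches its cap
  \<open>x v\<close> or is blocked by a tight set. In the end every coordinate below its cap lies in
  the greatest tight set, where the total loss is at most \<open>c\<close>.\<close>

lemma truncate:
  assumes p: "0 < p" and x: "\<And>v. v \<in> V \<Longrightarrow> 0 \<le> x v"
    and c: "\<And>A. A \<subseteq> V \<Longrightarrow> sum x A \<le> p * real (mrank M A) + c"
  shows "\<exists>y. feasible V M p y \<and> (\<forall>v\<in>V. y v \<le> x v) \<and> sum x V - c \<le> sum y V"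
proof -
  have "\<exists>y. feasible V M p y \<and> (\<forall>v\<in>V. y v \<le> x v) \<and> (\<forall>v\<in>V - W. y v = 0) \<and>
      (\<forall>v\<in>W. y v = x v \<or> (\<exists>A. tight V M p y A \<and> v \<in> A))" if "W \<subseteq> V" for W
    using finite_subset[OF that finite_ground] that
  proof (induction W rule: finite_induct)
    case empty
    show ?case using x p by (intro exI[of _ "\<lambda>_. 0"]) (auto simp: feasible_def)
  next
    case (insert w W)
    then obtain y where y: "feasible V M p y" "\<forall>v\<in>V. y v \<le> x v" "\<forall>v\<in>V - W. y v = 0"
      "\<forall>v\<in>W. y v = x v \<or> (\<exists>A. tight V M p y A \<and> v \<in> A)" by auto
    have w: "w \<in> V" "y w = 0" using insert y by auto
    define S where "S = (\<lambda>A. p * real (mrank M A) - sum y A) ` {A. A \<subseteq> V \<and> w \<in> A}"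
    have S: "finite S" "S \<noteq> {}" using finite_ground w by (auto simp: S_def)
    then have "Min S \<in> S" by simp
    then obtain A where A: "A \<subseteq> V" "w \<in> A" "Min S = p * real (mrank M A) - sum y A"
      by (auto simp: S_def)
    have "0 \<le> Min S" using A y(1) by (simp add: feasible_def)
    define d where "d = min (Min S) (x w)"
    have d: "0 \<le> d" "d \<le> x w" using x[OF w(1)] \<open>0 \<le> Min S\<close> by (auto simp: d_def)
    have slack: "d \<le> p * real (mrank M B) - sum y B" if "B \<subseteq> V" "w \<in> B" for B
      using Min_le[OF S(1), of "p * real (mrank M B) - sum y B"] that by (auto simp: d_def S_def)
    define y' where "y' = y(w := d)"
    have sum': "sum y' B = sum y B + (if w \<in> B then d else 0)" if "B \<subseteq> V" for B
    proof (cases "w \<in> B")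
      case True
      have "finite B" using that finite_ground finite_subset by blast
      then have "sum y B = y w + sum y (B - {w})" "sum y' B = y' w + sum y' (B - {w})"
        using True by (auto simp: sum.remove)
      moreover have "sum y' (B - {w}) = sum y (B - {w})" by (intro sum.cong) (auto simp: y'_def)
      ultimately show ?thesis using True w by (simp add: y'_def)
    next
      case False
      then show ?thesis by (auto simp: y'_def intro!: sum.cong)
    qed
    have "feasible V M p y'"
      unfolding feasible_def
    proof (intro conjI ballI allI impI)
      fix v assume "v \<in> V"
      then show "0 \<le> y' v" using y(1) d by (auto simp: y'_def feasible_def)
    next
      fix B assume B: "B \<subseteq> V"
      then show "sum y' B \<le> p * real (mrank M B)"
        using sum'[OF B] slack[OF B] y(1) by (auto simp: feasible_def)
    qed
    moreover have "\<forall>v\<in>V. y' v \<le> x v" using y(2) d by (auto simp: y'_def)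
    moreover have "\<forall>v\<in>V - insert w W. y' v = 0" using y(3) by (auto simp: y'_def)
    moreover have "y' v = x v \<or> (\<exists>A. tight V M p y' A \<and> v \<in> A)" if v: "v \<in> insert w W" for v
    proof (cases "v = w")
      case True
      show ?thesis
      proof (cases "d = x w")
        case True then show ?thesis using \<open>v = w\<close> by (simp add: y'_def)
      next
        case False
        then have "d = Min S" by (auto simp: d_def min_def split: if_splits)
        then have "tight V M p y' A" using A sum'[OF A(1)] by (simp add: tight_def)
        then show ?thesis using A True by blast
      qed
    next
      case False
      then have "y v = x v \<or> (\<exists>A. tight V M p y A \<and> v \<in> A)" "y' v = y v"
        using v y(4) by (auto simp: y'_def)
      \<comment> \<open>A tight set containing \<open>w\<close> forces \<open>d = 0\<close>, so
        raising \<open>w\<close> never disturbs a tight set.\<close>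
      moreover have "tight V M p y' B" if B: "tight V M p y B" for B
      proof -
        have BV: "B \<subseteq> V" and eqB: "sum y B = p * real (mrank M B)" using B by (auto simp: tight_def)
        have "w \<in> B \<Longrightarrow> d = 0" using slack[OF BV] eqB d(1) by linarith
        then show ?thesis using sum'[OF BV] BV eqB by (simp add: tight_def split: if_splits)
      qed
      ultimately show ?thesis by metis
    qed
    ultimately show ?case by blast
  qed
  from this[OF subset_refl] obtain y where y: "feasible V M p y" "\<forall>v\<in>V. y v \<le> x v"
    "\<forall>v\<in>V. y v = x v \<or> (\<exists>A. tight V M p y A \<and> v \<in> A)" by blast
  obtain T where T: "tight V M p y T" and max: "\<And>B. tight V M p y B \<Longrightarrow> B \<subseteq> T"
    using greatest_tight[OF y(1) p, of "\<lambda>_. True"] by blast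
  have TV: "T \<subseteq> V" using T by (simp add: tight_def)
  have "sum y (V - T) = sum x (V - T)" using y(3) max by (intro sum.cong) auto
  moreover have "sum y V = sum y (V - T) + sum y T" "sum x V = sum x (V - T) + sum x T"
    using TV finite_ground by (auto intro!: sum.subset_diff)
  moreover have "sum x T - c \<le> sum y T" using c[OF TV] T by (simp add: tight_def)
  ultimately show ?thesis using y by (intro exI[of _ y]) auto
qed

text \<open>Contraction lowers ranks by at most \<open>card D\<close>, so \<open>truncate\<close>
  applies with the constant \<open>p * card D\<close>.\<close>

lemma feasible_contract:
  assumes x: "feasible V M p x" and p: "0 < p" and D: "D \<in> M"
  shows "\<exists>y. feasible V (contract M D) p y \<and> (\<forall>v\<in>V. y v \<le> x v) \<and> sum x V - p * card D \<le> sum y V"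
proof -
  interpret c: loopy_matroid V "contract M D" by (rule loopy_matroid_contract[OF D])
  show ?thesis
  proof (rule c.truncate[OF p])
    fix A assume A: "A \<subseteq> V"
    have "sum x A \<le> p * real (mrank M A)" using x A by (simp add: feasible_def)
    also have "\<dots> \<le> p * (real (mrank (contract M D) A) + real (card D))"
    proof (rule mult_left_mono)
      have "mrank M A \<le> mrank M (A \<union> D)" by (rule mrank_mono) simp
      then show "real (mrank M A) \<le> real (mrank (contract M D) A) + real (card D)"
        using mrank_contract[OF D, of A] by linarith
    qed (use p in simp)
    finally show "sum x A \<le> p * real (mrank (contract M D) A) + p * card D"
      by (simp add: distrib_left)
  qed (use x in \<open>simp add: feasible_def\<close>)
qed

end

text \<open>Moving along a vector that is balanced on all tight classes makes a further constraint
  tight, so a feasible vector with the maximal number of tight constraints works.\<close>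

lemma feasible_full_coordinate:
  assumes M: "loopy_matroid V M" and N: "loopy_matroid V N" and p: "0 < p" "p \<le> q"
    and x: "feasible V M p x" "feasible V N q x" and pos: "0 < sum x V"
  shows "\<exists>y. feasible V M p y \<and> feasible V N q y \<and> sum x V \<le> sum y V \<and> (\<exists>v\<in>V. y v = p)"
proof -
  interpret M: loopy_matroid V M by (rule M)
  interpret N: loopy_matroid V N by (rule N)
  have q: "0 < q" using p by simp
  have V: "finite V" by (rule M.finite_ground)
  define good where "good y \<longleftrightarrow> feasible V M p y \<and> feasible V N q y \<and> sum x V \<le> sum y V" for y
  define Z where "Z y = {v \<in> V. y v = 0}" for y :: "'a \<Rightarrow> real"
  define T where "T y = card (Z y) + card {A. tight V M p y A} + card {A. tight V N q y A}" for y
  have "good x" using x by (simp add: good_def)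
  have "T y \<le> card V + card (Pow V) + card (Pow V)" for y
    unfolding T_def Z_def using V by (intro add_mono card_mono) (auto simp: tight_def)
  then have bound: "T y < Suc (card V + card (Pow V) + card (Pow V))" for y
    by (simp only: less_Suc_eq_le)
  have "\<exists>y. good y \<and> (\<forall>y'. good y' \<longrightarrow> T y' \<le> T y)"
    by (rule Lattices_Big.ex_has_greatest_nat[where P = good and k = x and f = T
        and b = "Suc (card V + card (Pow V) + card (Pow V))"])
      (use \<open>good x\<close> bound in simp_all)
  then obtain y where y: "good y" "\<And>y'. good y' \<Longrightarrow> T y' \<le> T y" by blast
  have yM: "feasible V M p y" and yN: "feasible V N q y" and yV: "sum x V \<le> sum y V"
    using y(1) by (auto simp: good_def)
  have nonneg: "0 \<le> y v" if "v \<in> V" for v using yM that by (simp add: feasible_def)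
  show ?thesis
  proof (cases "\<exists>v\<in>V. y v = p")
    case True then show ?thesis using yM yN yV by blast
  next
    case False
    define U where "U = {v \<in> V. 0 < y v}"
    \<comment> \<open>All coordinates are then below both \<open>p\<close> and \<open>q\<close>, so
      the tight classes of both matroids have at least two elements.\<close>
    have less: "y v < p" if "v \<in> V" for v
      using M.feasible_le[OF yM that p(1)] False that by fastforce
    have less': "y v < q" if "v \<in> V" for v using less[OF that] p by simp
    have U: "finite U" "U \<noteq> {}"
    proof -
      show "finite U" using V by (simp add: U_def)
      show "U \<noteq> {}"
      proof
        assume "U = {}"
        then have "sum y V \<le> 0" by (intro sum_nonpos) (auto simp: U_def not_less)
        then show False using pos yV by simp
      qed
    qed
    from M.tight_partition[OF yM p(1) less, folded U_def] obtain \<A>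
      where "(\<forall>P\<in>\<A>. P \<subseteq> U \<and> 2 \<le> card P) \<and> pairwise disjnt \<A> \<and>
        (\<forall>(z :: 'a \<Rightarrow> real) A. (\<forall>v. v \<notin> U \<longrightarrow> z v = 0) \<longrightarrow> (\<forall>P\<in>\<A>. sum z P = 0) \<longrightarrow>
          tight V M p y A \<longrightarrow> sum z A = 0)" ..
    then have A: "\<And>P. P \<in> \<A> \<Longrightarrow> P \<subseteq> U \<and> 2 \<le> card P" "pairwise disjnt \<A>"
      and tA: "\<And>(z :: 'a \<Rightarrow> real) A. \<forall>v. v \<notin> U \<longrightarrow> z v = 0 \<Longrightarrow> \<forall>P\<in>\<A>. sum z P = 0 \<Longrightarrow>
        tight V M p y A \<Longrightarrow> sum z A = 0"
      by simp_all
    from N.tight_partition[OF yN q less', folded U_def] obtain \<B>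
      where "(\<forall>P\<in>\<B>. P \<subseteq> U \<and> 2 \<le> card P) \<and> pairwise disjnt \<B> \<and>
        (\<forall>(z :: 'a \<Rightarrow> real) A. (\<forall>v. v \<notin> U \<longrightarrow> z v = 0) \<longrightarrow> (\<forall>P\<in>\<B>. sum z P = 0) \<longrightarrow>
          tight V N q y A \<longrightarrow> sum z A = 0)" ..
    then have B: "\<And>P. P \<in> \<B> \<Longrightarrow> P \<subseteq> U \<and> 2 \<le> card P" "pairwise disjnt \<B>"
      and tB: "\<And>(z :: 'a \<Rightarrow> real) A. \<forall>v. v \<notin> U \<longrightarrow> z v = 0 \<Longrightarrow> \<forall>P\<in>\<B>. sum z P = 0 \<Longrightarrow>
        tight V N q y A \<Longrightarrow> sum z A = 0"
      by simp_all
    obtain z0 :: "'a \<Rightarrow> real" where z0: "\<exists>u\<in>U. z0 u \<noteq> 0" "\<forall>v. v \<notin> U \<longrightarrow> z0 v = 0"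
      "\<forall>P\<in>\<A> \<union> \<B>. sum z0 P = 0"
      using exists_balanced_vector[OF U A B] by blast
    \<comment> \<open>The sign is chosen such that the total weight does not drop.\<close>
    define z where "z = (if 0 \<le> sum z0 V then z0 else (\<lambda>v. - z0 v))"
    have z: "\<exists>u\<in>U. z u \<noteq> 0" "\<forall>v. v \<notin> U \<longrightarrow> z v = 0" "\<forall>P\<in>\<A>. sum z P = 0" "\<forall>P\<in>\<B>. sum z P = 0"
      "0 \<le> sum z V"
      using z0 by (auto simp: z_def sum_negf)
    have tM: "sum z A = 0" if "tight V M p y A" for A using that by (rule tA[OF z(2,3)])
    have tN: "sum z A = 0" if "tight V N q y A" for A using that by (rule tB[OF z(2,4)])
    have UV: "U \<subseteq> V" by (auto simp: U_def)
    \<comment> \<open>Some coordinate grows, because \<open>z\<close> is nonzero with nonnegative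
      sum; its singleton constraint bounds the movement.\<close>
    have "\<exists>v\<in>V. 0 < z v"
    proof (rule ccontr)
      assume no: "\<not> ?thesis"
      then have le: "z v \<le> 0" if "v \<in> V" for v using that by force
      then have "sum z V = 0" using z(5) sum_nonpos[of V z] by force
      then have "(\<Sum>v\<in>V. - z v) = 0" by (simp add: sum_negf)
      then have "\<forall>v\<in>V. - z v = 0" using le by (subst (asm) sum_nonneg_eq_0_iff[OF V]) simp_all
      then show False using z(1) UV by force
    qed
    then obtain v0 where v0: "v0 \<in> V" "0 < z v0" by blast
    define I where "I = (\<lambda>v. (y v, - z v)) ` V \<union>
      (\<lambda>A. (p * real (mrank M A) - sum y A, sum z A)) ` Pow V \<union>
      (\<lambda>A. (q * real (mrank N A) - sum y A, sum z A)) ` Pow V"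
    have "\<exists>t. (\<forall>(s, d)\<in>I. t * d \<le> s) \<and> (\<exists>(s, d)\<in>I. 0 < s \<and> t * d = s) \<and> 0 < t"
    proof (rule first_hit)
      show "finite I" unfolding I_def using V by simp
      have "(p * real (mrank M {v0}) - sum y {v0}, sum z {v0}) \<in> I"
        unfolding I_def using v0 by blast
      then show "\<exists>(s, d)\<in>I. 0 < d" using v0 by force
      fix s d assume "(s, d) \<in> I"
      then consider v where "v \<in> V" "s = y v" "d = - z v"
        | A where "A \<subseteq> V" "s = p * real (mrank M A) - sum y A" "d = sum z A"
        | A where "A \<subseteq> V" "s = q * real (mrank N A) - sum y A" "d = sum z A"
        unfolding I_def by blast
      then show "0 \<le> s \<and> (s = 0 \<longrightarrow> d = 0)"
      proof cases
        case 1
        then show ?thesis using nonneg z(2) by (auto simp: U_def)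
      next
        case 2
        then show ?thesis using yM tM[of A] by (auto simp: feasible_def tight_def)
      next
        case 3
        then show ?thesis using yN tN[of A] by (auto simp: feasible_def tight_def)
      qed
    qed
    then obtain t s d where t: "\<And>s d. (s, d) \<in> I \<Longrightarrow> t * d \<le> s" "0 < t"
      and sd: "(s, d) \<in> I" "0 < s" "t * d = s" by blast
    define y' where "y' v = y v + t * z v" for v
    have sum': "sum y' A = sum y A + t * sum z A" for A
      by (simp add: y'_def sum.distrib sum_distrib_left)
    have in1: "(y v, - z v) \<in> I" if "v \<in> V" for v using that by (auto simp: I_def)
    have in2: "(p * real (mrank M A) - sum y A, sum z A) \<in> I" if "A \<subseteq> V" for A
      using that by (auto simp: I_def)
    have in3: "(q * real (mrank N A) - sum y A, sum z A) \<in> I" if "A \<subseteq> V" for A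
      using that by (auto simp: I_def)
    have nonneg': "0 \<le> y' v" if "v \<in> V" for v
      using t(1)[OF in1[OF that]] by (simp add: y'_def)
    have "good y'"
      unfolding good_def feasible_def
    proof (intro conjI ballI allI impI)
      show "sum x V \<le> sum y' V" 
        using yV mult_nonneg_nonneg[OF less_imp_le[OF t(2)] z(5)] unfolding sum' by linarith
      show "sum y' A \<le> p * real (mrank M A)" if "A \<subseteq> V" for A
        using t(1)[OF in2[OF that]] by (simp add: sum')
      show "sum y' A \<le> q * real (mrank N A)" if "A \<subseteq> V" for A
        using t(1)[OF in3[OF that]] by (simp add: sum')
    qed (rule nonneg', assumption)+
    moreover have "T y < T y'"
    proof -
      have sub: "Z y \<subseteq> Z y'" "{A. tight V M p y A} \<subseteq> {A. tight V M p y' A}"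
        "{A. tight V N q y A} \<subseteq> {A. tight V N q y' A}"
      proof -
        show "Z y \<subseteq> Z y'" using z(2) by (auto simp: Z_def U_def y'_def)
        have "tight V M p y' A" if "tight V M p y A" for A
          using that tM[OF that] by (simp add: tight_def sum')
        then show "{A. tight V M p y A} \<subseteq> {A. tight V M p y' A}" by blast
        have "tight V N q y' A" if "tight V N q y A" for A
          using that tN[OF that] by (simp add: tight_def sum')
        then show "{A. tight V N q y A} \<subseteq> {A. tight V N q y' A}" by blast
      qed
      have fin: "finite (Z y')" "finite {A. tight V M p y' A}" "finite {A. tight V N q y' A}"
        using V M.finite_tight N.finite_tight by (auto simp: Z_def)
      \<comment> \<open>The constraint that is hit had slack \<open>0 < s\<close> before, so it is
        newly tight.\<close>
      have "Z y \<noteq> Z y' \<or> {A. tight V M p y A} \<noteq> {A. tight V M p y' A} \<or>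
          {A. tight V N q y A} \<noteq> {A. tight V N q y' A}"
      proof -
        consider v where "v \<in> V" "s = y v" "d = - z v"
          | A where "A \<subseteq> V" "s = p * real (mrank M A) - sum y A" "d = sum z A"
          | A where "A \<subseteq> V" "s = q * real (mrank N A) - sum y A" "d = sum z A"
          using sd(1) unfolding I_def by blast
        then show ?thesis
        proof cases
          case 1
          then have "v \<in> Z y'" "v \<notin> Z y" using sd by (auto simp: Z_def y'_def)
          then show ?thesis by blast
        next
          case 2
          then have "tight V M p y' A" "\<not> tight V M p y A" using sd by (auto simp: tight_def sum')
          then show ?thesis by blast
        next
          case 3
          then have "tight V N q y' A" "\<not> tight V N q y A" using sd by (auto simp: tight_def sum')
          then show ?thesis by blast
        qed
      qed
      moreover have "card (Z y) \<le> card (Z y')" "card {A. tight V M p y A} \<le> card {A. tight V M p y' A}"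
        "card {A. tight V N q y A} \<le> card {A. tight V N q y' A}"
        using sub fin by (auto intro: card_mono)
      moreover have "card (Z y) < card (Z y')" if "Z y \<noteq> Z y'"
        using that sub fin by (intro psubset_card_mono) auto
      moreover have "card {A. tight V M p y A} < card {A. tight V M p y' A}"
        if "{A. tight V M p y A} \<noteq> {A. tight V M p y' A}"
        using that sub fin by (intro psubset_card_mono) auto
      moreover have "card {A. tight V N q y A} < card {A. tight V N q y' A}"
        if "{A. tight V N q y A} \<noteq> {A. tight V N q y' A}"
        using that sub fin by (intro psubset_card_mono) auto
      ultimately show ?thesis unfolding T_def by linarith
    qed
    ultimately show ?thesis using y(2) by fastforce
  qed
qed

section \<open>Connectivity of the intersection\<close>

context loopy_matroid
begin

text \<open>\<open>insert v D\<close> is the fundamental circuit of \<open>v\<close> with respect to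
  \<open>s\<close>, found as a minimal obstruction.\<close>

lemma minimal_extension_obstruction:
  assumes s: "s \<in> M" "insert v s \<notin> M"
  shows "\<exists>D\<subseteq>s. v \<notin> D \<and> insert v D \<notin> M \<and> (\<forall>u\<in>D. insert v (D - {u}) \<in> M)"
proof -
  let ?F = "{D. D \<subseteq> s \<and> insert v D \<notin> M}"
  have fin: "finite ?F" by (rule finite_subset[of _ "Pow s"]) (use finite_indep[OF s(1)] in auto)
  have "?F \<noteq> {}" using s by auto
  from finite_has_minimal[OF fin this] obtain D where D: "D \<in> ?F"
    and min: "\<forall>B\<in>?F. B \<le> D \<longrightarrow> D = B" ..
  have "v \<notin> D"
  proof
    assume "v \<in> D"
    then have "insert v D \<subseteq> s" using D by auto
    then show False using D indep_subset[OF s(1)] by simp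
  qed
  moreover have "insert v (D - {u}) \<in> M" if u: "u \<in> D" for u
  proof (rule ccontr)
    assume "insert v (D - {u}) \<notin> M"
    then have "D - {u} \<in> ?F" using D by auto
    then have "D = D - {u}" by (rule min[rule_format]) auto
    then show False using u by blast
  qed
  ultimately show ?thesis using D by (intro exI[of _ D]) auto
qed

end

text \<open>Truncate for each contraction separately and take the pointwise minimum; both
  truncations lie below \<open>y\<close>, so at worst the losses add up. An element of
  \<open>D\<close> that is a loop of \<open>contract N E\<close> loses its weight in both
  truncations but only once in the minimum, whence the refund.\<close>

lemma feasible_contract_both:
  assumes M: "loopy_matroid V M" and N: "loopy_matroid V N" and p: "0 < p" "0 < q"
    and y: "feasible V M p y" "feasible V N q y" and DE: "D \<in> M" "E \<in> N"
  shows "\<exists>x. feasible V (contract M D) p x \<and> feasible V (contract N E) q x \<and>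
    sum y V - p * card D - q * card E + (\<Sum>v\<in>V \<inter> (D \<inter> {v. {v} \<notin> contract N E}). y v) \<le> sum x V"
proof -
  interpret M: loopy_matroid V M by (rule M)
  interpret N: loopy_matroid V N by (rule N)
  interpret cM: loopy_matroid V "contract M D" by (rule M.loopy_matroid_contract[OF DE(1)])
  interpret cN: loopy_matroid V "contract N E" by (rule N.loopy_matroid_contract[OF DE(2)])
  let ?L = "V \<inter> (D \<inter> {v. {v} \<notin> contract N E})"
  obtain a where a: "feasible V (contract M D) p a" "\<forall>v\<in>V. a v \<le> y v"
    "sum y V - p * card D \<le> sum a V"
    using M.feasible_contract[OF y(1) p(1) DE(1)] by blast
  obtain b where b: "feasible V (contract N E) q b" "\<forall>v\<in>V. b v \<le> y v"
    "sum y V - q * card E \<le> sum b V"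
    using N.feasible_contract[OF y(2) p(2) DE(2)] by blast
  define x where "x v = min (a v) (b v)" for v
  have V: "finite V" by (rule M.finite_ground)
  have "feasible V (contract M D) p x" "feasible V (contract N E) q x"
    using a(1) b(1) feasible_nonneg[OF a(1)] feasible_nonneg[OF b(1)]
    by (auto simp: x_def intro: feasible_mono)
  moreover have "sum a V + sum b V + sum y ?L \<le> sum y V + sum x V"
  proof -
    have "a v + b v + (if v \<in> ?L then y v else 0) \<le> y v + x v" if v: "v \<in> V" for v
    proof (cases "v \<in> ?L")
      case True
      have "{v} \<notin> contract M D" using True by (auto simp: contract_def)
      then have "a v = 0" by (rule cM.feasible_loop[OF a(1) v])
      moreover have "b v = 0" using True by (intro cN.feasible_loop[OF b(1) v]) auto
      ultimately show ?thesis using True by (simp add: x_def)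
    next
      case False
      then show ?thesis using a(2) b(2) v by (auto simp: x_def min_def)
    qed
    then have "(\<Sum>v\<in>V. a v + b v + (if v \<in> ?L then y v else 0)) \<le> (\<Sum>v\<in>V. y v + x v)"
      by (rule sum_mono)
    moreover have "(\<Sum>v\<in>V. if v \<in> ?L then y v else 0) = sum y ?L"
      using V by (intro sum.mono_neutral_cong_right) auto
    ultimately show ?thesis by (simp add: sum.distrib)
  qed
  ultimately show ?thesis using a(3) b(3) by (intro exI[of _ x]) auto
qed

text \<open>For \<open>p \<le> q\<close> there is a coordinate \<open>v\<close> of weight exactly
  \<open>p\<close>. Contracting \<open>M\<close> by \<open>insert v D\<close> instead of
  \<open>D\<close> costs \<open>p\<close> more, which \<open>v\<close> refunds.\<close>

lemma acyclic_below_Int_step: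
  assumes M: "loopy_matroid V M" and N: "loopy_matroid V N" and p: "0 < p" "p \<le> q"
    and x: "feasible V M p x" "feasible V N q x" and n: "(p + q) * (real n - 1) < sum x V" "0 < n"
    and IH: "\<And>m K L y. m < n \<Longrightarrow> loopy_matroid V K \<Longrightarrow> loopy_matroid V L \<Longrightarrow>
      feasible V K p y \<Longrightarrow> feasible V L q y \<Longrightarrow> (p + q) * (real m - 1) < sum y V \<Longrightarrow>
      acyclic_below V (K \<inter> L) m"
  shows "acyclic_below V (M \<inter> N) n"
proof -
  interpret M: loopy_matroid V M by (rule M)
  interpret N: loopy_matroid V N by (rule N)
  have q: "0 < q" using p by simp
  have V: "finite V" by (rule M.finite_ground)
  have "0 \<le> (p + q) * (real n - 1)" using p q n(2) by simp
  then have "0 < sum x V" using n(1) by linarith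
  then obtain y v where y: "feasible V M p y" "feasible V N q y" "sum x V \<le> sum y V"
    and v: "v \<in> V" "y v = p"
    using feasible_full_coordinate[OF M N p x] by blast
  have vM: "{v} \<in> M" using M.feasible_loop[OF y(1) v(1)] v p by auto
  have vN: "{v} \<in> N" using N.feasible_loop[OF y(2) v(1)] v p by auto
  \<comment> \<open>The induction hypothesis for \<open>n - k\<close> tolerates a net loss of weight
    of at most \<open>(p + q) * k\<close>.\<close>
  have descend: "acyclic_below V (contract M D \<inter> contract N E) (n - k)"
    if DE: "D \<in> M" "E \<in> N" and k: "0 < k"
      and le: "p * card D + q * card E \<le> (p + q) * real k + (\<Sum>v\<in>V \<inter> (D \<inter> {v. {v} \<notin> contract N E}). y v)"
    for D E k
  proof (cases "k \<le> n")
    case False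
    then show ?thesis by (simp add: acyclic_below_def)
  next
    case True
    obtain z where z: "feasible V (contract M D) p z" "feasible V (contract N E) q z"
      "sum y V - p * card D - q * card E + (\<Sum>v\<in>V \<inter> (D \<inter> {v. {v} \<notin> contract N E}). y v) \<le> sum z V"
      using feasible_contract_both[OF M N p(1) q y(1,2) DE] by blast
    have "(p + q) * (real (n - k) - 1) = (p + q) * (real n - 1) - (p + q) * real k"
      using True by (simp add: of_nat_diff algebra_simps)
    then have "(p + q) * (real (n - k) - 1) < sum z V" using n(1) y(3) z(3) le by linarith
    moreover have "n - k < n" using k n(2) by simp
    ultimately show ?thesis
      using z M.loopy_matroid_contract[OF DE(1)] N.loopy_matroid_contract[OF DE(2)] by (intro IH)
  qed
  have finP: "finite F" if "F \<subseteq> Pow V" for F using that V finite_subset by blast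
  \<comment> \<open>An obstruction is nonempty because \<open>{v}\<close> is independent; hence the
    links fall under the induction hypothesis.\<close>
  have card_pos: "0 < card D" if "D \<in> M" "insert v D \<notin> K" "{v} \<in> K" for D K
    using that M.finite_indep[OF that(1)] by (metis card_gt_0_iff)
  \<comment> \<open>\<open>C\<close> consists of the faces to which \<open>v\<close> can be added in
    \<open>M\<close>. \<open>F\<close> and \<open>G\<close> are the circuits through
    \<open>v\<close> in \<open>M\<close> and in \<open>N\<close>, with \<open>v\<close> removed,
    that are faces of \<open>M \<inter> N\<close> and of \<open>C\<close>, respectively.\<close>
  define C where "C = {s \<in> N. insert v s \<in> M}"
  define F where "F = {D \<in> M \<inter> N. v \<notin> D \<and> insert v D \<notin> M \<and> (\<forall>u\<in>D. insert v (D - {u}) \<in> M)}"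
  define G where "G = {D \<in> C. v \<notin> D \<and> insert v D \<notin> N \<and> (\<forall>u\<in>D. insert v (D - {u}) \<in> N)}"
  have downC: "t \<in> C" if "s \<in> C" "t \<subseteq> s" for s t
    using that N.indep_subset[of s t] M.indep_subset[of "insert v s" "insert v t"]
    by (auto simp: C_def)
  have CM: "s \<in> M" if "s \<in> C" for s
    using that M.indep_subset[of "insert v s" s] by (auto simp: C_def)
  have "acyclic_below V {s \<in> C. \<forall>D\<in>G. \<not> D \<subseteq> s} n"
  proof (rule acyclic_below_cone[OF V v(1)])
    show "{s \<in> C. \<forall>D\<in>G. \<not> D \<subseteq> s} \<subseteq> Pow V"
      using N.indep_subset_ground by (auto simp: C_def)
    fix s assume s: "s \<in> {s \<in> C. \<forall>D\<in>G. \<not> D \<subseteq> s}"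
    have "insert v s \<in> N"
    proof (rule ccontr)
      assume "insert v s \<notin> N"
      then obtain D where "D \<subseteq> s" "v \<notin> D" "insert v D \<notin> N" "\<forall>u\<in>D. insert v (D - {u}) \<in> N"
        using N.minimal_extension_obstruction[of s v] s by (auto simp: C_def)
      then have "D \<in> G" using s downC[of s D] by (simp add: G_def)
      then show False using s \<open>D \<subseteq> s\<close> by blast
    qed
    then have "insert v s \<in> C" using s by (simp add: C_def)
    moreover have "\<not> D \<subseteq> insert v s" if "D \<in> G" for D
      using that \<open>insert v s \<in> N\<close> N.indep_subset[of "insert v s" "insert v D"] by (auto simp: G_def)
    ultimately show "insert v s \<in> {s \<in> C. \<forall>D\<in>G. \<not> D \<subseteq> s}" by blast
  qed
  have "acyclic_below V C n"
  proof (rule acyclic_below_remove_faces[where F = G])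
    show "C \<subseteq> Pow V" "G \<subseteq> Pow V" using N.indep_subset_ground by (auto simp: C_def G_def)
    then show "finite G" by (intro finP)
    show "acyclic_below V {s \<in> C. \<forall>D\<in>G. \<not> D \<subseteq> s} n" by fact
    show "t \<in> C" if "s \<in> C" "t \<subseteq> s" for s t by (rule downC[OF that])
    show "D \<union> E \<notin> C" if "D \<in> G" "E \<in> G" "D \<noteq> E" for D E
    proof
      assume "D \<union> E \<in> C"
      then have "D \<union> E \<in> N" by (simp add: C_def)
      then show False using that by (intro N.two_circuits[of D E v]) (auto simp: G_def)
    qed
    fix D assume D: "D \<in> G"
    then have D': "D \<in> N" "insert v D \<in> M" "v \<notin> D" "insert v D \<notin> N" by (auto simp: G_def C_def)
    have "link C D = contract M (insert v D) \<inter> contract N D"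
    proof -
      have "v \<notin> t" if "t \<union> D \<in> N" for t
        using that D'(4) N.indep_subset[of "t \<union> D" "insert v D"] by auto
      then show ?thesis by (auto simp: link_def contract_def C_def)
    qed
    moreover have "acyclic_below V (contract M (insert v D) \<inter> contract N D) (n - card D)"
    proof (rule descend)
      have finD: "finite D" by (rule N.finite_indep[OF D'(1)])
      show "0 < card D" using D' vN CM D by (intro card_pos[of D N]) (auto simp: G_def)
      \<comment> \<open>\<open>v\<close> lies in \<open>insert v D\<close> and is a loop of
        \<open>contract N D\<close>, so its weight is part of the refund.\<close>
      have "y v \<le> sum y (V \<inter> (insert v D \<inter> {v. {v} \<notin> contract N D}))"
      proof (rule member_le_sum)
        show "v \<in> V \<inter> (insert v D \<inter> {v. {v} \<notin> contract N D})"
          using v D' by (auto simp: contract_def)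
      qed (use V feasible_nonneg[OF y(1)] in auto)
      then show "p * card (insert v D) + q * card D
          \<le> (p + q) * real (card D) + sum y (V \<inter> (insert v D \<inter> {v. {v} \<notin> contract N D}))"
        using v finD D' by (simp add: algebra_simps)
    qed (use D' in auto)
    ultimately show "acyclic_below V (link C D) (n - card D)" by (simp only:)
  qed (rule V)
  also have "C = {s \<in> M \<inter> N. \<forall>D\<in>F. \<not> D \<subseteq> s}"
  proof (intro subset_antisym subsetI)
    fix s assume s: "s \<in> C"
    have "\<not> D \<subseteq> s" if "D \<in> F" for D
      using that s M.indep_subset[of "insert v s" "insert v D"] by (auto simp: F_def C_def)
    then show "s \<in> {s \<in> M \<inter> N. \<forall>D\<in>F. \<not> D \<subseteq> s}" using s CM[OF s] by (auto simp: C_def)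
  next
    fix s assume s: "s \<in> {s \<in> M \<inter> N. \<forall>D\<in>F. \<not> D \<subseteq> s}"
    have "insert v s \<in> M"
    proof (rule ccontr)
      assume "insert v s \<notin> M"
      then obtain D where "D \<subseteq> s" "v \<notin> D" "insert v D \<notin> M" "\<forall>u\<in>D. insert v (D - {u}) \<in> M"
        using M.minimal_extension_obstruction[of s v] s by auto
      then have "D \<in> F" using s M.indep_subset[of s D] N.indep_subset[of s D] by (simp add: F_def)
      then show False using s \<open>D \<subseteq> s\<close> by blast
    qed
    then show "s \<in> C" using s by (simp add: C_def)
  qed
  finally have rest: "acyclic_below V {s \<in> M \<inter> N. \<forall>D\<in>F. \<not> D \<subseteq> s} n" .
  show ?thesis
  proof (rule acyclic_below_remove_faces[where F = F])
    show "M \<inter> N \<subseteq> Pow V" "F \<subseteq> Pow V" using N.indep_subset_ground by (auto simp: F_def)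
    then show "finite F" by (intro finP)
    show "acyclic_below V {s \<in> M \<inter> N. \<forall>D\<in>F. \<not> D \<subseteq> s} n" by (rule rest)
    show "t \<in> M \<inter> N" if "s \<in> M \<inter> N" "t \<subseteq> s" for s t
      using that M.indep_subset[of s t] N.indep_subset[of s t] by simp
    show "D \<union> E \<notin> M \<inter> N" if "D \<in> F" "E \<in> F" "D \<noteq> E" for D E
    proof
      assume "D \<union> E \<in> M \<inter> N"
      then show False using that by (intro M.two_circuits[of D E v]) (auto simp: F_def)
    qed
    fix D assume D: "D \<in> F"
    then have D': "D \<in> M" "D \<in> N" "insert v D \<notin> M" by (auto simp: F_def)
    have "link (M \<inter> N) D = contract M D \<inter> contract N D"
      by (auto simp: link_def contract_def)
    moreover have "acyclic_below V (contract M D \<inter> contract N D) (n - card D)"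
    proof (rule descend)
      show "0 < card D" using D' vM by (intro card_pos[of D M])
      have "0 \<le> sum y (V \<inter> (D \<inter> {v. {v} \<notin> contract N D}))"
        using feasible_nonneg[OF y(1)] by (intro sum_nonneg) auto
      then show "p * card D + q * card D
          \<le> (p + q) * real (card D) + sum y (V \<inter> (D \<inter> {v. {v} \<notin> contract N D}))"
        by (simp add: algebra_simps)
    qed (use D' in auto)
    ultimately show "acyclic_below V (link (M \<inter> N) D) (n - card D)" by (simp only:)
  qed (rule V)
qed

text \<open>Strong induction on \<open>n\<close>, with the matroids and factors exchanged if
  \<open>q < p\<close>. The strict bound on \<open>n - 1\<close> admits every \<open>n\<close> up to
  the ceiling of \<open>sum x V / (p + q)\<close>.\<close>

theorem acyclic_below_Int:
  assumes "loopy_matroid V M" "loopy_matroid V N" "0 < p" "0 < q"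
    and "feasible V M p x" "feasible V N q x" "(p + q) * (real n - 1) < sum x V"
  shows "acyclic_below V (M \<inter> N) n"
  using assms(1,2,5-)
proof (induction n arbitrary: M N x rule: less_induct)
  case (less n)
  show ?case
  proof (cases "n = 0")
    case True
    then show ?thesis by (simp add: acyclic_below_def)
  next
    case False
    show ?thesis
    proof (cases "p \<le> q")
      case True
      show ?thesis
        by (rule acyclic_below_Int_step[OF less.prems(1,2) assms(3) True less.prems(3-5)])
          (use False less.IH in auto)
    next
      case F: False
      have "acyclic_below V (N \<inter> M) n"
      proof (rule acyclic_below_Int_step[OF less.prems(2,1) assms(4) _ less.prems(4,3)])
        show "q \<le> p" using F by simp
        show "(q + p) * (real n - 1) < sum x V" using less.prems(5) by (simp add: add.commute)
        show "acyclic_below V (K \<inter> L) m"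
          if "m < n" "loopy_matroid V K" "loopy_matroid V L" "feasible V K q y" "feasible V L p y"
            "(q + p) * (real m - 1) < sum y V" for m K L y
          using less.IH[OF that(1,3,2,5,4)] that(6) by (simp add: add.commute Int_commute)
      qed (use False in simp)
      then show ?thesis by (simp add: Int_commute)
    qed
  qed
qed

section \<open>Colouring by disjoint copies\<close>

text \<open>The \<open>k\<close>-fold direct sum of the restriction of \<open>M\<close> to
  \<open>J\<close>. Elements with a colour outside \<open>J\<close> are loops, which lets one ground
  set serve all \<open>J\<close>.\<close>

definition copies :: "'a set set \<Rightarrow> 'a set \<Rightarrow> nat \<Rightarrow> ('a \<times> nat) set set" where
  "copies M J k = {S. S \<subseteq> J \<times> {..<k} \<and> (\<forall>i<k. {v. (v, i) \<in> S} \<in> M)}"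

text \<open>Restricting the colours gives a complex of the same form, to which the connectivity
  bound applies.\<close>

lemma copies_restrict:
  assumes "J \<subseteq> V"
  shows "copies M J k = {S \<in> copies M V k. fst ` S \<subseteq> J}"
proof -
  have "S \<subseteq> J \<times> {..<k} \<longleftrightarrow> S \<subseteq> V \<times> {..<k} \<and> fst ` S \<subseteq> J" for S
    using assms unfolding subset_iff image_iff mem_Times_iff by blast
  then show ?thesis unfolding copies_def by auto
qed

lemma card_slices:
  fixes S :: "('a \<times> nat) set"
  assumes "finite S" "S \<subseteq> J \<times> {..<k}"
  shows "card S = (\<Sum>i<k. card {v. (v, i) \<in> S})"
proof -
  have fin: "finite {v. (v, i) \<in> S}" for i
    by (rule finite_subset[of _ "fst ` S"]) (use assms in force)+
  have "S = prod.swap ` (SIGMA i:{..<k}. {v. (v, i) \<in> S})" using assms(2) by force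
  then have "card S = card (SIGMA i:{..<k}. {v. (v, i) \<in> S})"
    by (metis card_image inj_swap)
  then show ?thesis using fin by (subst (asm) card_SigmaI) auto
qed

text \<open>If \<open>T\<close> is larger than \<open>S\<close>, then so is one of its slices, and
  one augments in that copy.\<close>

lemma loopy_matroid_copies:
  assumes M: "loopy_matroid V M" and J: "J \<subseteq> V"
  shows "loopy_matroid (V \<times> {..<k}) (copies M J k)"
proof
  interpret M: loopy_matroid V M by (rule M)
  show fin: "finite (V \<times> {..<k})" using M.finite_ground by simp
  fix S T
  show "S \<subseteq> V \<times> {..<k}" if "S \<in> copies M J k" using that J by (auto simp: copies_def)
  show "{} \<in> copies M J k" using M.empty_indep by (simp add: copies_def)
  show "T \<in> copies M J k" if S: "S \<in> copies M J k" "T \<subseteq> S"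
    unfolding copies_def
  proof (intro CollectI conjI allI impI)
    show "T \<subseteq> J \<times> {..<k}" using S by (auto simp: copies_def)
    fix i assume "i < k"
    then have "{v. (v, i) \<in> S} \<in> M" using S by (simp add: copies_def)
    then show "{v. (v, i) \<in> T} \<in> M" by (rule M.indep_subset) (use S in auto)
  qed
  show "\<exists>e\<in>T - S. insert e S \<in> copies M J k"
    if ST: "S \<in> copies M J k" "T \<in> copies M J k" and card: "card S < card T"
  proof -
    have sub: "S \<subseteq> J \<times> {..<k}" "T \<subseteq> J \<times> {..<k}" using ST by (auto simp: copies_def)
    have "J \<times> {..<k} \<subseteq> V \<times> {..<k}" using J by auto
    then have finS: "finite S" "finite T" using sub fin finite_subset by (meson subset_trans)+
    have "\<exists>i<k. card {v. (v, i) \<in> S} < card {v. (v, i) \<in> T}"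
    proof (rule ccontr)
      assume "\<not> ?thesis"
      then have "card T \<le> card S"
        unfolding card_slices[OF finS(1) sub(1)] card_slices[OF finS(2) sub(2)]
        by (intro sum_mono leI) blast
      then show False using card by simp
    qed
    then obtain i where i: "i < k" "card {v. (v, i) \<in> S} < card {v. (v, i) \<in> T}" by blast
    then obtain u where u: "u \<in> {v. (v, i) \<in> T} - {v. (v, i) \<in> S}" "insert u {v. (v, i) \<in> S} \<in> M"
      using M.augment[of "{v. (v, i) \<in> S}" "{v. (v, i) \<in> T}"] ST by (auto simp: copies_def)
    have slice: "{v. (v, j) \<in> insert (u, i) S} = (if j = i then insert u {v. (v, i) \<in> S} else {v. (v, j) \<in> S})" for j
      by auto
    have "insert (u, i) S \<in> copies M J k"
      unfolding copies_def mem_Collect_eq slice using u ST sub by (auto simp: copies_def)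
    then show ?thesis using u by (intro bexI[of _ "(u, i)"]) auto
  qed
qed

text \<open>The cover \<open>K\<close> splits the part of \<open>A\<close> over \<open>J\<close>
  into at most \<open>card K\<close> pieces, each independent because its slices lie in a member of
  \<open>K\<close>.\<close>

lemma feasible_copies:
  assumes M: "loopy_matroid V M" and J: "J \<subseteq> V" and K: "finite K" "K \<subseteq> M" "\<Union>K = V"
  shows "feasible (V \<times> {..<k}) (copies M J k) (real (card K)) (\<lambda>e. if e \<in> J \<times> {..<k} then 1 else 0)"
  unfolding feasible_def
proof (intro conjI ballI allI impI)
  interpret M: loopy_matroid V M by (rule M)
  interpret c: loopy_matroid "V \<times> {..<k}" "copies M J k" by (rule loopy_matroid_copies[OF M J])
  fix A assume A: "A \<subseteq> V \<times> {..<k}"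
  let ?J = "J \<times> {..<k}"
  have finA: "finite A" using A c.finite_ground finite_subset by blast
  have "A \<inter> ?J = (\<Union>I\<in>K. A \<inter> ?J \<inter> I \<times> UNIV)"
  proof
    show "A \<inter> ?J \<subseteq> (\<Union>I\<in>K. A \<inter> ?J \<inter> I \<times> UNIV)"
    proof
      fix e assume e: "e \<in> A \<inter> ?J"
      then have "fst e \<in> \<Union>K" using J K(3) by auto
      then obtain I where "I \<in> K" "fst e \<in> I" by blast
      then show "e \<in> (\<Union>I\<in>K. A \<inter> ?J \<inter> I \<times> UNIV)" using e by (intro UN_I[of I]) (auto simp: mem_Times_iff)
    qed
  qed auto
  then have "card (A \<inter> ?J) \<le> (\<Sum>I\<in>K. card (A \<inter> ?J \<inter> I \<times> UNIV))"
    using card_UN_le[OF K(1), of "\<lambda>I. A \<inter> ?J \<inter> I \<times> UNIV"] by simp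
  also have "\<dots> \<le> (\<Sum>I\<in>K. mrank (copies M J k) A)"
  proof (rule sum_mono)
    fix I assume "I \<in> K"
    then have "I \<in> M" using K by auto
    then have "A \<inter> ?J \<inter> I \<times> UNIV \<in> copies M J k"
      by (auto simp: copies_def intro: M.indep_subset)
    then show "card (A \<inter> ?J \<inter> I \<times> UNIV) \<le> mrank (copies M J k) A"
      by (rule c.card_le_mrank) auto
  qed
  finally have "card (A \<inter> ?J) \<le> card K * mrank (copies M J k) A" by simp
  then have "real (card (A \<inter> ?J)) \<le> real (card K) * real (mrank (copies M J k) A)"
    by (metis of_nat_le_iff of_nat_mult)
  moreover have "(\<Sum>e\<in>A. if e \<in> ?J then 1 else 0) = real (card (A \<inter> ?J))"
    using finA by (simp add: sum.If_cases Int_def)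
  ultimately show "(\<Sum>e\<in>A. if e \<in> ?J then 1 else 0) \<le> real (card K) * real (mrank (copies M J k) A)"
    by simp
qed simp

section \<open>Covers and the chromatic number\<close>

lemma loopy_matroid_if_matroid_on:
  assumes "matroid_on V M"
  shows "loopy_matroid V M"
proof
  have M: "finite V" "M \<noteq> {}" "\<And>S T. S \<in> M \<Longrightarrow> T \<subseteq> S \<Longrightarrow> T \<in> M" "\<Union>M = V"
    using assms unfolding matroid_on_def complex_on_def by blast+
  show "finite V" by (rule M(1))
  show "{} \<in> M" using M(2,3) by blast
  fix S T
  show "S \<subseteq> V" if "S \<in> M" using that M(4) by blast
  show "T \<in> M" if "S \<in> M" "T \<subseteq> S" using that by (rule M(3))
  show "\<exists>v\<in>T - S. insert v S \<in> M" if "S \<in> M" "T \<in> M" "card S < card T"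
  proof -
    have "\<forall>S\<in>M. \<forall>T\<in>M. card S < card T \<longrightarrow> (\<exists>v\<in>T - S. S \<union> {v} \<in> M)"
      using assms unfolding matroid_on_def by (elim conjE)
    from this[rule_format, OF that] show ?thesis by simp
  qed
qed

lemma chromatic_number_le:
  assumes "F \<subseteq> C" "finite F" "\<Union>F = V"
  shows "chromatic_number V C \<le> card F"
  unfolding chromatic_number_def using assms by (intro Least_le) blast

lemma chromatic_number_attained:
  assumes "matroid_on V M"
  obtains F where "F \<subseteq> M" "finite F" "card F = chromatic_number V M" "\<Union>F = V"
proof -
  have "\<exists>k F. F \<subseteq> M \<and> finite F \<and> card F = k \<and> \<Union>F = V"
    using assms exists_finite_cover unfolding matroid_on_def by blast
  then have "\<exists>F. F \<subseteq> M \<and> finite F \<and> card F = chromatic_number V M \<and> \<Union>F = V"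
    unfolding chromatic_number_def by (rule LeastI_ex)
  then show ?thesis using that by blast
qed

theorem theorem1p1:
  fixes V :: "'a set" and M N :: "'a set set"
  assumes "matroid_on V M" and "matroid_on V N"
  shows "chromatic_number V (M \<inter> N) \<le> chromatic_number V M + chromatic_number V N"
proof (cases "V = {}")
  case True
  then show ?thesis using chromatic_number_le[of "{}" "M \<inter> N" V] by simp
next
  case False
  have M: "loopy_matroid V M" and N: "loopy_matroid V N"
    using assms by (auto intro: loopy_matroid_if_matroid_on)
  obtain K where K: "K \<subseteq> M" "finite K" "card K = chromatic_number V M" "\<Union>K = V"
    using chromatic_number_attained[OF assms(1)] .
  obtain L where L: "L \<subseteq> N" "finite L" "card L = chromatic_number V N" "\<Union>L = V"
    using chromatic_number_attained[OF assms(2)] .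
  define k where "k = card K + card L"
  \<comment> \<open>The two chromatic numbers serve as the factors \<open>p\<close> and
    \<open>q\<close>; they are positive since \<open>V\<close> is nonempty.\<close>
  have pos: "0 < real (card K)" "0 < real (card L)" using K L False by (auto simp: card_gt_0_iff)
  have V: "finite V" using assms by (simp add: matroid_on_def)
  let ?C = "\<lambda>J. copies M J k \<inter> copies N J k"
  interpret M: loopy_matroid "V \<times> {..<k}" "copies M V k" by (rule loopy_matroid_copies[OF M subset_refl])
  interpret N: loopy_matroid "V \<times> {..<k}" "copies N V k" by (rule loopy_matroid_copies[OF N subset_refl])
  have "\<exists>s\<in>?C V. rainbow fst V s"
  proof (rule rainbow_face[OF M.finite_ground])
    show "?C V \<subseteq> Pow (V \<times> {..<k})" using M.indep_subset_ground by auto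
    show "t \<in> ?C V" if "s \<in> ?C V" "t \<subseteq> s" for s t
      using that M.indep_subset[of s t] N.indep_subset[of s t] by simp
    show "{} \<in> ?C V" using M.empty_indep N.empty_indep by simp
    show "finite V" by (rule V)
    fix J assume J: "J \<subseteq> V"
    let ?x = "\<lambda>e. if e \<in> J \<times> {..<k} then 1 else 0 :: real"
    \<comment> \<open>The total weight is \<open>k * card J\<close>, strictly above the threshold
      \<open>k * (card J - 1)\<close> for acyclicity below \<open>card J\<close>.\<close>
    have "sum ?x (V \<times> {..<k}) = sum (\<lambda>_. 1) (J \<times> {..<k})"
      using V J by (intro sum.mono_neutral_cong_right) auto
    then have sumx: "sum ?x (V \<times> {..<k}) = (real (card K) + real (card L)) * real (card J)"
      by (simp add: k_def card_cartesian_product)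
    have "acyclic_below (V \<times> {..<k}) (?C J) (card J)"
    proof (rule acyclic_below_Int[OF _ _ pos])
      show "(real (card K) + real (card L)) * (real (card J) - 1) < sum ?x (V \<times> {..<k})"
        unfolding sumx using pos by (simp add: algebra_simps)
    qed (rule loopy_matroid_copies[OF M J] loopy_matroid_copies[OF N J]
        feasible_copies[OF M J K(2,1,4)] feasible_copies[OF N J L(2,1,4)])+
    moreover have "?C J = {s \<in> ?C V. fst ` s \<subseteq> J}"
      unfolding copies_restrict[OF J] by blast
    ultimately show "acyclic_below (V \<times> {..<k}) {s \<in> ?C V. fst ` s \<subseteq> J} (card J)"
      by (simp only:)
  qed
  then obtain s where s: "s \<in> copies M V k" "s \<in> copies N V k" "fst ` s = V"
    by (auto simp: rainbow_def)
  \<comment> \<open>The slices of the rainbow face are common independent sets; they cover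
    \<open>V\<close> because every colour occurs.\<close>
  let ?F = "(\<lambda>i. {v. (v, i) \<in> s}) ` {..<k}"
  have "?F \<subseteq> M \<inter> N" using s by (auto simp: copies_def)
  moreover have "\<Union>?F = V"
  proof -
    have "s \<subseteq> V \<times> {..<k}" using s by (simp add: copies_def)
    show ?thesis
    proof
      show "\<Union>?F \<subseteq> V" using \<open>s \<subseteq> V \<times> {..<k}\<close> by blast
      show "V \<subseteq> \<Union>?F"
      proof
        fix v assume "v \<in> V"
        then obtain i where "(v, i) \<in> s" using s(3) by (metis imageE prod.collapse)
        moreover have "i < k" using calculation \<open>s \<subseteq> V \<times> {..<k}\<close> by blast
        ultimately show "v \<in> \<Union>?F" by blast
      qed
    qed
  qed
  ultimately have "chromatic_number V (M \<inter> N) \<le> card ?F" by (intro chromatic_number_le) auto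
  also have "\<dots> \<le> k" using card_image_le[of "{..<k}" "\<lambda>i. {v. (v, i) \<in> s}"] by simp
  finally show ?thesis using K L by (simp add: k_def)
qed

end
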